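(* Let $u,v\in S_n$ and $\mathbf{a}\in[n]^n$. (1) If $u\le_{\mathbf{a}}v$, then $\mathcal{T}^\circ_{u,v}\subseteq X^\circ_{v,\mathbf{a}}\cap\Omega^\circ_{u,\mathbf{a}}$. (2) If $u\lesssim_{\mathbf{a}}v$, then $\mathcal{T}^\circ_{u,v}=X^\circ_{v,\mathbf{a}}\cap\Omega^\circ_{u,\mathbf{a}}$.
   Context: $\mathrm{Fl}_n$ is the variety of complete flags $F_\bullet$ in $\mathbb{C}^n$; a flag is represented by an invertible matrix $M$ whose first $k$ columns span $F_k$; $\mathrm{rank}_S(F_k)$ is the rank of the submatrix of $M$ with rows $S\subseteq[n]$ and first $k$ columns; $\Delta_{i_1,\dots,i_k}(F_\bullet)$ is the minor with rows $i_1,\dots,i_k$ and first $k$ columns; for $I=\{i_1,\dots,i_k\}$, $\Delta_I$ denotes this minor (its vanishing does not depend on the order); $\Delta_w:=\prod_k\Delta_{w[k]}$ for $w\in S_n$ (one-line notation, $w[k]:=\{w_1,\dots,w_k\}$). Cyclic interval $[a,b)_c$: $\{a,\dots,b-1\}$ if $a\le b$ (empty if $a=b$), $\{a,\dots,n\}\cup\{1,\dots,b-1\}$ if $a>b$. For $r\in[n]$, $<_r$ is the total order $r<_r r+1<_r\cdots<_r n<_r1<_r\cdots<_r r-1$; for $k$-subsets $A=\{a_1<_r\cdots<_r a_k\}$, $B=\{b_1<_r\cdots<_r b_k\}$, $A\le_r B$ iff $a_i\le_r b_i$ for all $i$. For $\mathbf{a}\in[n]^n$: $u\le_{\mathbf{a}}v$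 iff $u[k]\le_{a_k}v[k]$ for all $k\in[n]$; $u\lesssim_{\mathbf{a}}v$ iff additionally $|u[k]\cap[a_k,a_{k+1})_c|=|v[k]\cap[a_k,a_{k+1})_c|$ for all $k\in[n-1]$. The open tilted Richardson variety $\mathcal{T}^\circ_{u,v}$ is the set of flags with $\mathrm{rank}_{[b_k,i)_c}(F_k)=|u[k]\cap[b_k,i)_c|$ and $\mathrm{rank}_{[i,b_k)_c}(F_k)=|v[k]\cap[i,b_k)_c|$ for all $i,k\in[n]$, for any $\mathbf{b}\in[n]^n$ with $u\le_{\mathbf{b}}v$ (independent of this choice). Tilted Rothe diagrams: $D_{\mathbf{a}}(w):=\{(w_i,k):i>k,\ w_i<_{a_k}w_k\}$, $D^{\mathrm{op}}_{\mathbf{a}}(w):=\{(w_i,k):i>k,\ w_i>_{a_k}w_k\}$. Tilted Schubert cells: $X^\circ_{w,\mathbf{a}}:=\{F_\bullet:\Delta_w(F_\bullet)\ne0,\ \Delta_{w[k-1]\cup\{i\}}(F_\bullet)=0\ \forall (i,k)\in D^{\mathrm{op}}_{\mathbf{a}}(w)\}$ and $\Omega^\circ_{w,\mathbf{a}}:=\{F_\bullet:\Delta_w(F_\bullet)\ne0,\ \Delta_{w[k-1]\cup\{i\}}(F_\bullet)=0\ \forall (i,k)\in D_{\mathbf{a}}(w)\}$. *)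

theory Defs
  imports
    Complex_Main
    "HOL-Combinatorics.Permutations"
    "Jordan_Normal_Form.DL_Rank_Submatrix"
begin

text \<open>
  Rows, columns, permutations and the entries of \<open>a\<close> are indexed by \<open>{1..n}\<close>.  Matrices and vectors of
  \<open>Jordan_Normal_Form\<close> are indexed from \<open>0\<close>, so row \<open>i\<close> here is row \<open>i - 1\<close> there.
\<close>

section \<open>Complete flags\<close>

abbreviation Cvec :: "nat \<Rightarrow> (complex, complex vec) module" where
  "Cvec n \<equiv> module_vec TYPE(complex) n"

definition sub_dim :: "nat \<Rightarrow> complex vec set \<Rightarrow> nat" where
  "sub_dim n W = vectorspace.dim class_ring (Cvec n\<lparr>carrier := W\<rparr>)"

definition Fl :: "nat \<Rightarrow> (nat \<Rightarrow> complex vec set) set" where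
  "Fl n = {F \<in> extensional {..n}.
     (\<forall>k\<le>n. VectorSpace.subspace class_ring (F k) (Cvec n) \<and> sub_dim n (F k) = k) \<and>
     (\<forall>k<n. F k \<subseteq> F (Suc k))}"

definition represents :: "nat \<Rightarrow> complex mat \<Rightarrow> (nat \<Rightarrow> complex vec set) \<Rightarrow> bool" where
  "represents n M F \<longleftrightarrow> M \<in> carrier_mat n n \<and> invertible_mat M \<and>
     (\<forall>k\<le>n. F k = LinearCombinations.module.span class_ring (Cvec n) (col M ` {..<k}))"

text \<open>
  Every flag has a representing matrix (\<open>Fl_represented\<close>).  The ranks below and the vanishing of the
  minors do not depend on it (\<open>flag_rank_represents\<close>, \<open>flag_minor_eq_0_represents\<close>); only these are used.
\<close>

definition flag_mat :: "nat \<Rightarrow> (nat \<Rightarrow> complex vec set) \<Rightarrow> complex mat" where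
  "flag_mat n F = (SOME M. represents n M F)"

definition rows_cols :: "complex mat \<Rightarrow> nat set \<Rightarrow> nat \<Rightarrow> complex mat" where
  "rows_cols M S k = submatrix M {i. Suc i \<in> S} {..<k}"

definition mat_rank :: "complex mat \<Rightarrow> nat" where
  "mat_rank A = vec_space.rank (dim_row A) A"

definition flag_rank :: "nat \<Rightarrow> (nat \<Rightarrow> complex vec set) \<Rightarrow> nat set \<Rightarrow> nat \<Rightarrow> nat" where
  "flag_rank n F S k = mat_rank (rows_cols (flag_mat n F) S k)"

definition flag_minor :: "nat \<Rightarrow> (nat \<Rightarrow> complex vec set) \<Rightarrow> nat set \<Rightarrow> complex" where
  "flag_minor n F I = det (rows_cols (flag_mat n F) I (card I))"

definition flag_minor_perm :: "nat \<Rightarrow> (nat \<Rightarrow> complex vec set) \<Rightarrow> (nat \<Rightarrow> nat) \<Rightarrow> complex" where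
  "flag_minor_perm n F w = (\<Prod>k\<in>{1..n}. flag_minor n F (w ` {1..k}))"

section \<open>Cyclic intervals and tilted orders\<close>

definition cyc_ivl :: "nat \<Rightarrow> nat \<Rightarrow> nat \<Rightarrow> nat set" where
  "cyc_ivl n a b = (if a \<le> b then {a..<b} else {a..n} \<union> {1..<b})"

definition cyc_list :: "nat \<Rightarrow> nat \<Rightarrow> nat list" where
  "cyc_list n r = [r..<Suc n] @ [1..<r]"

text \<open>\<open>x\<close> comes strictly before \<open>y\<close> in the list \<open>r, r + 1, \<dots>, n, 1, \<dots>, r - 1\<close>.\<close>

definition cyc_less :: "nat \<Rightarrow> nat \<Rightarrow> nat \<Rightarrow> nat \<Rightarrow> bool" where
  "cyc_less n r x y \<longleftrightarrow>
     (\<exists>i j. i < j \<and> j < length (cyc_list n r) \<and> cyc_list n r ! i = x \<and> cyc_list n r ! j = y)"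

text \<open>The filtered list enumerates the subset increasingly with respect to \<open>cyc_less n r\<close>.\<close>

definition cyc_subset_le :: "nat \<Rightarrow> nat \<Rightarrow> nat set \<Rightarrow> nat set \<Rightarrow> bool" where
  "cyc_subset_le n r A B \<longleftrightarrow>
     list_all2 (\<lambda>x y. cyc_less n r x y \<or> x = y)
       (filter (\<lambda>x. x \<in> A) (cyc_list n r)) (filter (\<lambda>x. x \<in> B) (cyc_list n r))"

definition tilted_le :: "nat \<Rightarrow> (nat \<Rightarrow> nat) \<Rightarrow> (nat \<Rightarrow> nat) \<Rightarrow> (nat \<Rightarrow> nat) \<Rightarrow> bool" where
  "tilted_le n a u v \<longleftrightarrow> (\<forall>k\<in>{1..n}. cyc_subset_le n (a k) (u ` {1..k}) (v ` {1..k}))"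

definition tilted_lesssim :: "nat \<Rightarrow> (nat \<Rightarrow> nat) \<Rightarrow> (nat \<Rightarrow> nat) \<Rightarrow> (nat \<Rightarrow> nat) \<Rightarrow> bool" where
  "tilted_lesssim n a u v \<longleftrightarrow> tilted_le n a u v \<and>
     (\<forall>k\<in>{1..<n}. card (u ` {1..k} \<inter> cyc_ivl n (a k) (a (Suc k))) =
                  card (v ` {1..k} \<inter> cyc_ivl n (a k) (a (Suc k))))"

section \<open>Tilted Richardson varieties and tilted Schubert cells\<close>

definition tilted_rank_conds ::
  "nat \<Rightarrow> (nat \<Rightarrow> nat) \<Rightarrow> (nat \<Rightarrow> nat) \<Rightarrow> (nat \<Rightarrow> nat) \<Rightarrow> (nat \<Rightarrow> complex vec set) \<Rightarrow> bool" where
  "tilted_rank_conds n b u v F \<longleftrightarrow> (\<forall>i\<in>{1..n}. \<forall>k\<in>{1..n}.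
     flag_rank n F (cyc_ivl n (b k) i) k = card (u ` {1..k} \<inter> cyc_ivl n (b k) i) \<and>
     flag_rank n F (cyc_ivl n i (b k)) k = card (v ` {1..k} \<inter> cyc_ivl n i (b k)))"

text \<open>
  Any \<open>b\<close> with \<open>u \<le>\<^sub>b v\<close> gives the same variety (\<open>tilted_richardson_eq\<close>), so \<open>for some b\<close> here
  is the same as \<open>for every b\<close>.
\<close>

definition tilted_richardson ::
  "nat \<Rightarrow> (nat \<Rightarrow> nat) \<Rightarrow> (nat \<Rightarrow> nat) \<Rightarrow> (nat \<Rightarrow> complex vec set) set" where
  "tilted_richardson n u v =
     {F \<in> Fl n. \<exists>b \<in> {1..n} \<rightarrow> {1..n}. tilted_le n b u v \<and> tilted_rank_conds n b u v F}"

definition rothe :: "nat \<Rightarrow> (nat \<Rightarrow> nat) \<Rightarrow> (nat \<Rightarrow> nat) \<Rightarrow> (nat \<times> nat) set" where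
  "rothe n a w = {(w i, k) | i k.
     i \<in> {1..n} \<and> k \<in> {1..n} \<and> i > k \<and> cyc_less n (a k) (w i) (w k)}"

definition rothe_op :: "nat \<Rightarrow> (nat \<Rightarrow> nat) \<Rightarrow> (nat \<Rightarrow> nat) \<Rightarrow> (nat \<times> nat) set" where
  "rothe_op n a w = {(w i, k) | i k.
     i \<in> {1..n} \<and> k \<in> {1..n} \<and> i > k \<and> cyc_less n (a k) (w k) (w i)}"

definition schubert_X ::
  "nat \<Rightarrow> (nat \<Rightarrow> nat) \<Rightarrow> (nat \<Rightarrow> nat) \<Rightarrow> (nat \<Rightarrow> complex vec set) set" where
  "schubert_X n w a = {F \<in> Fl n. flag_minor_perm n F w \<noteq> 0 \<and>
     (\<forall>(i, k) \<in> rothe_op n a w. flag_minor n F (w ` {1..<k} \<union> {i}) = 0)}"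

definition schubert_Omega ::
  "nat \<Rightarrow> (nat \<Rightarrow> nat) \<Rightarrow> (nat \<Rightarrow> nat) \<Rightarrow> (nat \<Rightarrow> complex vec set) set" where
  "schubert_Omega n w a = {F \<in> Fl n. flag_minor_perm n F w \<noteq> 0 \<and>
     (\<forall>(i, k) \<in> rothe n a w. flag_minor n F (w ` {1..<k} \<union> {i}) = 0)}"

section \<open>Well-definedness\<close>

subsection \<open>Representing matrices\<close>


lemma subspace_carrier:
  assumes "VectorSpace.subspace class_ring W (Cvec n)"
  shows "W \<subseteq> carrier_vec n"
  using assms unfolding VectorSpace.subspace_def submodule_def by (auto simp: module_vec_simps)

lemma subspace_basis:
  assumes W: "VectorSpace.subspace class_ring W (Cvec n)"
  obtains A where "finite A" "A \<subseteq> W" "LinearCombinations.module.lin_indpt class_ring (Cvec n) A"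
    "LinearCombinations.module.span class_ring (Cvec n) A = W" "card A = sub_dim n W"
    "vectorspace.fin_dim class_ring (Cvec n\<lparr>carrier := W\<rparr>)"
proof -
  interpret V: vec_space "TYPE(complex)" n .
  have sW: "W \<subseteq> carrier_vec n" using subspace_carrier[OF W] .
  let ?P = "\<lambda>m. \<exists>A. A \<subseteq> W \<and> V.lin_indpt A \<and> card A = m \<and> finite A"
  have "V.lin_indpt {}" unfolding V.lin_dep_def by auto
  hence P0: "?P 0" by (intro exI[of _ "{}"]) auto
  have bnd: "m \<le> n" if "?P m" for m
  proof -
    from that obtain A where A: "A \<subseteq> W" "V.lin_indpt A" "card A = m" by blast
    have "A \<subseteq> carrier_vec n" using A(1) sW by (rule subset_trans)
    from V.li_le_dim(2)[OF V.fin_dim _ A(2)] this show ?thesis using A(3) V.dim_is_n by simp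
  qed
  define m where "m = (GREATEST m. ?P m)"
  have m1: "?P m" unfolding m_def by (rule GreatestI_nat[of ?P 0 n, OF P0 bnd])
  have m2: "m' \<le> m" if "?P m'" for m' unfolding m_def by (rule Greatest_le_nat[of ?P m' n, OF that bnd])
  from m1 obtain A where A: "A \<subseteq> W" "V.lin_indpt A" "card A = m" "finite A" by blast
  have cA: "A \<subseteq> carrier_vec n" using A sW by auto
  have subW: "submodule class_ring W (Cvec n)" using W unfolding VectorSpace.subspace_def by simp
  have sub: "V.span A \<subseteq> W" using V.span_is_subset[OF A(1) subW] .
  have "W \<subseteq> V.span A"
  proof
    fix w assume w: "w \<in> W"
    show "w \<in> V.span A"
    proof (rule ccontr)
      assume nw: "w \<notin> V.span A"
      have "w \<notin> A" using nw V.in_own_span[of A] cA by auto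
      moreover have "V.lin_indpt (A \<union> {w})"
        using V.lin_dep_iff_in_span[of A w] nw A w sW cA \<open>w \<notin> A\<close> by auto
      moreover have "A \<union> {w} \<subseteq> W" "finite (A \<union> {w})" using A w by simp_all
      moreover have "card (A \<union> {w}) = Suc m" using A \<open>w \<notin> A\<close> by simp
      ultimately have "?P (Suc m)" by blast
      from m2[OF this] show False by simp
    qed
  qed
  hence sp: "V.span A = W" using sub by auto
  have "maximal A (\<lambda>T. T \<subseteq> A \<and> V.lin_indpt T)" using A unfolding maximal_def by auto
  hence "sub_dim n W = card A"
    using V.dim_span[of A A] cA A sp unfolding sub_dim_def by auto
  moreover have "vectorspace.fin_dim class_ring (Cvec n\<lparr>carrier := W\<rparr>)"
    using V.fin_dim_span[of A] A cA sp by auto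
  ultimately show thesis using that[OF A(4,1,2) sp] by simp
qed

lemma sub_dim_mono:
  assumes X: "VectorSpace.subspace class_ring X (Cvec n)"
    and Y: "VectorSpace.subspace class_ring Y (Cvec n)" and "X \<subseteq> Y"
  shows "sub_dim n X \<le> sub_dim n Y" and "sub_dim n X = sub_dim n Y \<Longrightarrow> X = Y"
proof -
  interpret V: vec_space "TYPE(complex)" n .
  obtain A where A: "finite A" "A \<subseteq> X" "V.lin_indpt A" "V.span A = X" "card A = sub_dim n X"
    by (rule subspace_basis[OF X])
  obtain B where B: "finite B" "B \<subseteq> Y" "V.lin_indpt B" "V.span B = Y" "card B = sub_dim n Y"
    by (rule subspace_basis[OF Y])
  have cB: "B \<subseteq> carrier_vec n" using B subspace_carrier[OF Y] by auto
  have cA: "A \<subseteq> carrier_vec n" using A subspace_carrier[OF X] by auto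
  have le: "card C \<le> sub_dim n Y" if C: "finite C" "V.lin_indpt C" "C \<subseteq> Y" for C
  proof -
    have "C \<subseteq> V.span B" using C(3) B(4) by simp
    then obtain D :: "complex vec set" where "int (card D) \<le> int (card B) - int (card C)"
      using V.replacement[OF C(1) B(1) _ C(2)] cB by auto
    thus ?thesis using B(5) by linarith
  qed
  show "sub_dim n X \<le> sub_dim n Y" using le[of A] A assms(3) by auto
  assume eq: "sub_dim n X = sub_dim n Y"
  show "X = Y"
  proof (rule ccontr)
    assume "X \<noteq> Y"
    then obtain y where y: "y \<in> Y" "y \<notin> X" using assms(3) by auto
    have ya: "y \<notin> A" using y A by auto
    have yc: "y \<in> carrier_vec n" using y subspace_carrier[OF Y] by auto
    have "V.lin_indpt (A \<union> {y})"
      using V.lin_dep_iff_in_span[of A y] y ya A cA yc by auto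
    hence "card (A \<union> {y}) \<le> sub_dim n Y" using le[of "A \<union> {y}"] A y assms(3) by auto
    thus False using ya A eq by auto
  qed
qed

lemma Fl_represented:
  assumes F: "F \<in> Fl n"
  shows "\<exists>M. represents n M F"
proof -
  interpret V: vec_space "TYPE(complex)" n .
  have sub: "VectorSpace.subspace class_ring (F k) (Cvec n)" and dm: "sub_dim n (F k) = k"
    if "k \<le> n" for k using F that unfolding Fl_def by auto
  have step: "F k \<subseteq> F (Suc k)" if "k < n" for k using F that unfolding Fl_def by auto
  have "\<exists>x. x \<in> F (Suc k) \<and> x \<notin> F k" if "k < n" for k
  proof -
    have "sub_dim n (F k) \<noteq> sub_dim n (F (Suc k))" using dm[of k] dm[of "Suc k"] that by simp
    hence "F k \<noteq> F (Suc k)" by metis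
    thus ?thesis using step[OF that] by blast
  qed
  then obtain f where f: "\<And>k. k < n \<Longrightarrow> f k \<in> F (Suc k) \<and> f k \<notin> F k" by metis
  have fc: "f k \<in> carrier_vec n" if "k < n" for k
    using f[OF that] subspace_carrier[OF sub[of "Suc k"]] that by auto
  have sp: "V.span (f ` {..<k}) = F k" if "k \<le> n" for k
    using that
  proof (induction k)
    case 0
    obtain A where A: "finite A" "V.span A = F 0" "card A = sub_dim n (F 0)"
      by (rule subspace_basis[OF sub[OF le0]])
    hence "A = {}" using dm[of 0] by simp
    thus ?case using A(2) by simp
  next
    case (Suc k)
    let ?S = "f ` {..<Suc k}"
    have c: "?S \<subseteq> carrier_vec n" using fc Suc.prems by auto
    have s1: "VectorSpace.subspace class_ring (V.span ?S) (Cvec n)"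
      using V.span_is_subspace[of ?S] c by simp
    have Fk: "F k \<subseteq> V.span ?S"
    proof -
      have "f ` {..<k} \<subseteq> ?S" by auto
      from V.span_is_monotone[OF this] show ?thesis using Suc by simp
    qed
    have fk: "f k \<in> V.span ?S" using V.in_own_span[of ?S] c by auto
    have "f ` {..<k} \<subseteq> carrier_vec n" using c by auto
    hence "f ` {..<k} \<subseteq> F k" using V.in_own_span[of "f ` {..<k}"] Suc by simp
    hence S: "?S \<subseteq> F (Suc k)" using f[of k] step[of k] Suc.prems by (auto simp: lessThan_Suc)
    have sub2: "V.span ?S \<subseteq> F (Suc k)"
      using V.span_is_subset[OF S] sub[OF Suc.prems] unfolding VectorSpace.subspace_def by auto
    have "sub_dim n (V.span ?S) \<ge> k" using sub_dim_mono(1)[OF sub[of k] s1 Fk] dm[of k] Suc.prems by auto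
    moreover have "sub_dim n (V.span ?S) \<noteq> k"
      using sub_dim_mono(2)[OF sub[of k] s1 Fk] dm[of k] Suc.prems f[of k] fk by auto
    moreover have "sub_dim n (V.span ?S) \<le> Suc k"
      using sub_dim_mono(1)[OF s1 sub[OF Suc.prems] sub2] dm[OF Suc.prems] by simp
    ultimately show ?case
      using sub_dim_mono(2)[OF s1 sub[OF Suc.prems] sub2] dm[OF Suc.prems] by auto
  qed
  define M where "M = mat n n (\<lambda>(i,j). f j $ i)"
  have M: "M \<in> carrier_mat n n" unfolding M_def by simp
  have colM: "col M j = f j" if "j < n" for j
    using that fc[OF that] unfolding M_def by (intro eq_vecI) auto
  have spM: "F k = V.span (col M ` {..<k})" if "k \<le> n" for k
  proof -
    have "col M ` {..<k} = f ` {..<k}" using colM that by (intro image_cong) auto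
    thus ?thesis using sp[OF that] by simp
  qed
  have "set (cols M) = col M ` {..<n}" using M unfolding cols_def by auto
  hence "V.rank M = n" using spM[of n] dm[of n] unfolding V.rank_def sub_dim_def by simp
  hence "det M \<noteq> 0" using V.det_rank_iff[OF M] by simp
  hence "invertible_mat M"
    using det_non_zero_imp_unit[OF M] M unfolding invertible_mat_def inverts_mat_def Units_def
    by (auto simp: ring_mat_simps)
  thus ?thesis using M spM unfolding represents_def by auto
qed

definition restr :: "nat set \<Rightarrow> nat \<Rightarrow> complex vec \<Rightarrow> complex vec" where
  "restr I n v = vec (card {i. i < n \<and> i \<in> I}) (\<lambda>i. v $ pick I i)"

lemma restr_eq_iff: "restr I n v = restr I n w \<longleftrightarrow> (\<forall>i<n. i \<in> I \<longrightarrow> v $ i = w $ i)"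
proof
  assume eq: "restr I n v = restr I n w"
  show "\<forall>i<n. i \<in> I \<longrightarrow> v $ i = w $ i"
  proof (intro allI impI)
    fix i assume i: "i < n" "i \<in> I"
    let ?c = "card {a \<in> I. a < i}"
    have "{a \<in> I. a < i} \<subset> {i. i < n \<and> i \<in> I}" using i by auto
    hence c: "?c < card {i. i < n \<and> i \<in> I}" by (intro psubset_card_mono) auto
    have "restr I n v $ ?c = restr I n w $ ?c" using eq by simp
    thus "v $ i = w $ i" using c pick_card_in_set[OF i(2)] unfolding restr_def by simp
  qed
next
  assume eq: "\<forall>i<n. i \<in> I \<longrightarrow> v $ i = w $ i"
  have "pick I j < n \<and> pick I j \<in> I" if j: "j < card {i. i < n \<and> i \<in> I}" for j
  proof -
    have "pick I j \<in> {a. a < n \<and> a \<in> I}"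
      unfolding pick_reduce_set[OF j] by (rule pick_in_set_le[OF j])
    thus ?thesis by simp
  qed
  thus "restr I n v = restr I n w" unfolding restr_def using eq by (intro eq_vecI) auto
qed

lemma restr_rank_nullity:
  fixes I :: "nat set"
  assumes W: "VectorSpace.subspace class_ring W (Cvec n)"
  defines "m \<equiv> card {i. i < n \<and> i \<in> I}"
  shows "sub_dim m (restr I n ` W) + sub_dim n {x \<in> W. \<forall>i<n. i \<in> I \<longrightarrow> x $ i = 0} = sub_dim n W"
    and "VectorSpace.subspace class_ring {x \<in> W. \<forall>i<n. i \<in> I \<longrightarrow> x $ i = 0} (Cvec n)"
    and "VectorSpace.subspace class_ring (restr I n ` W) (Cvec m)"
proof -
  interpret V: vec_space "TYPE(complex)" n .
  interpret U: vec_space "TYPE(complex)" m .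
  let ?f = "restr I n"
  have sW: "W \<subseteq> carrier_vec n" using subspace_carrier[OF W] .
  have pk: "pick I i < n" if "i < m" for i using pick_le that unfolding m_def by auto
  have add: "?f (x + y) = ?f x + ?f y" if "x \<in> W" "y \<in> W" for x y
    using that sW pk unfolding restr_def m_def[symmetric] by (intro eq_vecI) (auto simp: subset_iff)
  have smult: "?f (c \<cdot>\<^sub>v x) = c \<cdot>\<^sub>v ?f x" if "x \<in> W" for c x
    using that sW pk unfolding restr_def m_def[symmetric] by (intro eq_vecI) (auto simp: subset_iff)
  have car: "?f x \<in> carrier_vec m" for x unfolding restr_def m_def by simp
  have z: "(?f x = 0\<^sub>v m) = (\<forall>i<n. i \<in> I \<longrightarrow> x $ i = 0)" for x
  proof -
    have "0\<^sub>v m = ?f (0\<^sub>v n)" unfolding restr_def m_def[symmetric] using pk by (intro eq_vecI) auto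
    thus ?thesis using restr_eq_iff[of I n x "0\<^sub>v n"] by auto
  qed
  have fd: "vectorspace.fin_dim class_ring (Cvec n\<lparr>carrier := W\<rparr>)"
    using subspace_basis[OF W] by blast
  have vsW: "vectorspace class_ring (Cvec n\<lparr>carrier := W\<rparr>)"
    using V.subspace_is_vs[OF W] .
  have lm: "linear_map class_ring (Cvec n\<lparr>carrier := W\<rparr>) (Cvec m) ?f"
    unfolding linear_map_def mod_hom_def mod_hom_axioms_def LinearCombinations.module_hom_def
    using vsW U.vectorspace_axioms add smult car 
    by (auto simp: vectorspace_def module_vec_simps)
  interpret L: linear_map class_ring "Cvec n\<lparr>carrier := W\<rparr>" "Cvec m" ?f by (rule lm)
  show "sub_dim m (?f ` W) + sub_dim n {x \<in> W. \<forall>i<n. i \<in> I \<longrightarrow> x $ i = 0} = sub_dim n W"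
    using L.rank_nullity[OF fd] unfolding sub_dim_def L.im_def L.ker_def z[symmetric]
    by (simp add: module_vec_simps)
  show "VectorSpace.subspace class_ring (?f ` W) (Cvec m)"
    using L.imT_is_subspace unfolding L.im_def by simp
  show "VectorSpace.subspace class_ring {x \<in> W. \<forall>i<n. i \<in> I \<longrightarrow> x $ i = 0} (Cvec n)"
  proof -
    have W0: "0\<^sub>v n \<in> W" and Wadd: "\<And>x y. x \<in> W \<Longrightarrow> y \<in> W \<Longrightarrow> x + y \<in> W"
      and Wsm: "\<And>c x. x \<in> W \<Longrightarrow> c \<cdot>\<^sub>v x \<in> W"
      using W unfolding VectorSpace.subspace_def submodule_def by (simp_all add: module_vec_simps)
    have f0: "?f (0\<^sub>v n) = 0\<^sub>v m" using z[of "0\<^sub>v n"] by simp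
    have "submodule class_ring {x \<in> W. ?f x = 0\<^sub>v m} (Cvec n)"
      unfolding submodule_def
    proof (intro conjI allI impI)
      show "Module.module class_ring (Cvec n)" by (rule V.module_axioms)
      show "{x \<in> W. ?f x = 0\<^sub>v m} \<subseteq> carrier (Cvec n)" using sW by (auto simp: module_vec_simps)
      show "\<zero>\<^bsub>Cvec n\<^esub> \<in> {x \<in> W. ?f x = 0\<^sub>v m}" using W0 f0 by (simp add: module_vec_simps)
      fix x y assume "x \<in> {x \<in> W. ?f x = 0\<^sub>v m}" "y \<in> {x \<in> W. ?f x = 0\<^sub>v m}"
      thus "x \<oplus>\<^bsub>Cvec n\<^esub> y \<in> {x \<in> W. ?f x = 0\<^sub>v m}"
        using add Wadd by (simp add: module_vec_simps)
    next
      fix c :: complex and x assume "x \<in> {x \<in> W. ?f x = 0\<^sub>v m}"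
      thus "c \<odot>\<^bsub>Cvec n\<^esub> x \<in> {x \<in> W. ?f x = 0\<^sub>v m}"
        using smult Wsm by (simp add: module_vec_simps)
    qed
    thus ?thesis unfolding VectorSpace.subspace_def z[symmetric] using V.vectorspace_axioms by blast
  qed
qed

lemma rank_rows_cols:
  assumes R: "represents n M F" and k: "k \<le> n"
  shows "mat_rank (rows_cols M S k) = sub_dim (card {i. i < n \<and> i \<in> {i. Suc i \<in> S}}) (restr {i. Suc i \<in> S} n ` F k)"
proof -
  let ?I = "{i. Suc i \<in> S}"
  define m where "m = card {i. i < n \<and> i \<in> ?I}"
  interpret V: vec_space "TYPE(complex)" n .
  interpret U: vec_space "TYPE(complex)" m .
  have M: "M \<in> carrier_mat n n" using R unfolding represents_def by simp
  have ck: "card {j. j < n \<and> j < k} = k"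
  proof -
    have "{j. j < n \<and> j < k} = {..<k}" using k by auto
    thus ?thesis by simp
  qed
  have pk: "pick {..<k} j = j" if "j < k" for j
  proof -
    have "{a. a < k \<and> a < j} = {..<j}" using that by auto
    thus ?thesis using pick_card_in_set[of j "{..<k}"] that by auto
  qed
  define A where "A = mat n k (\<lambda>(i,j). M $$ (i,j))"
  have A: "A \<in> carrier_mat n k" unfolding A_def by simp
  let ?B = "rows_cols M S k"
  have B: "?B \<in> carrier_mat m k" unfolding rows_cols_def m_def
    using dim_submatrix[of M ?I "{..<k}"] M ck by auto
  have "set (cols A) = col M ` {..<k}"
  proof -
    have "col A j = col M j" if "j < k" for j using that k M unfolding A_def by (intro eq_vecI) auto
    thus ?thesis using A unfolding cols_def by (force simp: image_iff)
  qed
  hence "F k = V.col_space A" using R k unfolding represents_def V.col_space_def by auto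
  hence Fk: "F k = (\<lambda>x. A *\<^sub>v x) ` carrier_vec k" using V.col_space_eq[OF A] A by auto
  have "?B *\<^sub>v x = restr ?I n (A *\<^sub>v x)" if "x \<in> carrier_vec k" for x
  proof (rule eq_vecI)
    show "dim_vec (?B *\<^sub>v x) = dim_vec (restr ?I n (A *\<^sub>v x))" using B unfolding restr_def m_def by auto
    fix i assume "i < dim_vec (restr ?I n (A *\<^sub>v x))"
    hence i: "i < m" unfolding restr_def m_def by simp
    have pi: "pick ?I i < n" using pick_le[OF i[unfolded m_def]] .
    have "row ?B i = row A (pick ?I i)"
    proof (rule eq_vecI)
      show "dim_vec (row ?B i) = dim_vec (row A (pick ?I i))" using A B by simp
      fix j assume "j < dim_vec (row A (pick ?I i))"
      hence j: "j < k" using A by simp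
      have "?B $$ (i,j) = M $$ (pick ?I i, pick {..<k} j)"
        unfolding rows_cols_def using submatrix_index[of i M ?I j "{..<k}"] i[unfolded m_def] j M ck by simp
      thus "row ?B i $ j = row A (pick ?I i) $ j" using i j B pi pk[OF j] unfolding A_def by simp
    qed
    thus "(?B *\<^sub>v x) $ i = restr ?I n (A *\<^sub>v x) $ i" using i B A pi unfolding restr_def m_def[symmetric] by simp
  qed
  hence "restr ?I n ` F k = (\<lambda>x. ?B *\<^sub>v x) ` carrier_vec k" unfolding Fk image_image
    by (intro image_cong) auto
  moreover have "U.col_space ?B = (\<lambda>x. ?B *\<^sub>v x) ` carrier_vec k" using U.col_space_eq[OF B] B by auto
  moreover have "dim_row ?B = m" using B by auto
  ultimately show ?thesis unfolding mat_rank_def sub_dim_def U.col_space_def m_def[symmetric]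
    by (simp add: U.rank_def)
qed

lemma flag_mat_represents: "represents n M F \<Longrightarrow> represents n (flag_mat n F) F"
  unfolding flag_mat_def by (rule someI)

lemma flag_rank_represents:
  assumes "represents n M F" "k \<le> n"
  shows "flag_rank n F S k = mat_rank (rows_cols M S k)"
  unfolding flag_rank_def
  using rank_rows_cols[OF assms] rank_rows_cols[OF flag_mat_represents[OF assms(1)] assms(2)] by simp

lemma minor_rank:
  assumes R: "represents n M F" and I: "I \<subseteq> {1..n}"
  shows "det (rows_cols M I (card I)) = 0 \<longleftrightarrow> mat_rank (rows_cols M I (card I)) \<noteq> card I"
proof -
  interpret U: vec_space "TYPE(complex)" "card I" .
  have M: "M \<in> carrier_mat n n" using R unfolding represents_def by simp
  have "card I \<le> n" using card_mono[OF _ I] by simp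
  hence "{j. j < n \<and> j < card I} = {..<card I}" by auto
  hence c: "card {j. j < n \<and> j < card I} = card I" by simp
  have "Suc ` {i. i < n \<and> Suc i \<in> I} = I"
  proof -
    have "i \<in> Suc ` {i. i < n \<and> Suc i \<in> I}" if "i \<in> I" for i
      using that I by (intro image_eqI[of _ _ "i - 1"]) (auto simp: subset_iff)
    thus ?thesis by auto
  qed
  hence r: "card {i. i < n \<and> Suc i \<in> I} = card I" using card_image[of Suc "{i. i < n \<and> Suc i \<in> I}"] by simp
  have B: "rows_cols M I (card I) \<in> carrier_mat (card I) (card I)" unfolding rows_cols_def
    using dim_submatrix[of M "{i. Suc i \<in> I}" "{..<card I}"] M c r by auto
  show ?thesis using U.det_rank_iff[OF B] B unfolding mat_rank_def by auto
qed

lemma flag_minor_eq_0_represents: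
  assumes R: "represents n M F" and I: "I \<subseteq> {1..n}"
  shows "flag_minor n F I = 0 \<longleftrightarrow> det (rows_cols M I (card I)) = 0"
proof -
  have "card I \<le> n" using card_mono[OF _ I] by simp
  thus ?thesis unfolding flag_minor_def
    using minor_rank[OF R I] minor_rank[OF flag_mat_represents[OF R] I] flag_rank_represents[OF R, of "card I" I]
    unfolding flag_rank_def by simp
qed


subsection \<open>Independence of the tilted Richardson variety from \<open>b\<close>\<close>

lemma flag_rank_empty: "F \<in> Fl n \<Longrightarrow> k \<le> n \<Longrightarrow> flag_rank n F {} k = 0"
proof -
  assume F: "F \<in> Fl n" and k: "k \<le> n"
  interpret V: vec_space "TYPE(complex)" 0 .
  obtain M where M: "represents n M F" using Fl_represented[OF F] by auto
  have W: "VectorSpace.subspace class_ring (F k) (Cvec n)" using F k unfolding Fl_def by auto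
  have "sub_dim n {x \<in> F k. \<forall>i<n. i \<in> {} \<longrightarrow> x $ i = 0} = sub_dim n (F k)" by simp
  thus ?thesis using restr_rank_nullity(1)[OF W, of "{}"]
    unfolding flag_rank_represents[OF M k] rank_rows_cols[OF M k] by simp
qed

lemma flag_rank_split:
  assumes F: "F \<in> Fl n" and k: "k \<le> n"
    and cov: "S0 \<union> S1 = {1..n}" and sum: "flag_rank n F S0 k + flag_rank n F S1 k = k"
    and S: "S \<subseteq> S0"
  shows "flag_rank n F (S \<union> S1) k = flag_rank n F S k + flag_rank n F S1 k"
proof -
  obtain M where M: "represents n M F" using Fl_represented[OF F] by auto
  define W where "W = F k"
  define J where "J T = {i. Suc i \<in> T}" for T
  define d where "d T = card {i. i < n \<and> i \<in> J T}" for T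
  define Z where "Z T X = {x \<in> X. \<forall>i<n. i \<in> J T \<longrightarrow> x $ i = (0::complex)}" for T X
  have W: "VectorSpace.subspace class_ring W (Cvec n)" and dW: "sub_dim n W = k"
    using F k unfolding Fl_def W_def by auto
  have R: "flag_rank n F T k = sub_dim (d T) (restr (J T) n ` W)" for T
    unfolding flag_rank_represents[OF M k] rank_rows_cols[OF M k] d_def J_def W_def by simp
  have rn: "sub_dim (d T) (restr (J T) n ` X) + sub_dim n (Z T X) = sub_dim n X"
      "VectorSpace.subspace class_ring (Z T X) (Cvec n)"
      "VectorSpace.subspace class_ring (restr (J T) n ` X) (Cvec (d T))"
    if "VectorSpace.subspace class_ring X (Cvec n)" for T X
    using restr_rank_nullity[OF that, of "J T"] unfolding Z_def d_def by blast+
  let ?N = "Z S1 W"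
  have N: "VectorSpace.subspace class_ring ?N (Cvec n)" using rn(2)[OF W] by simp
  have NW: "?N \<subseteq> W" unfolding Z_def by auto
  have J01: "i < n \<Longrightarrow> i \<in> J S0 \<or> i \<in> J S1" for i
    using cov unfolding J_def by (metis Un_iff atLeastAtMost_iff le_add1 less_eq_Suc_le mem_Collect_eq plus_1_eq_Suc)
  interpret V: vec_space "TYPE(complex)" n .
  have sW: "W \<subseteq> carrier_vec n" by (rule subspace_carrier[OF W])
  have z0: "0\<^sub>v n \<in> W" using W unfolding VectorSpace.subspace_def submodule_def by (auto simp: module_vec_simps)
  have "Z S0 ?N = {0\<^sub>v n}"
  proof -
    have "x = 0\<^sub>v n" if "x \<in> Z S0 ?N" for x
      using that J01 sW unfolding Z_def by (intro eq_vecI) auto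
    moreover have "0\<^sub>v n \<in> Z S0 ?N" using z0 unfolding Z_def by auto
    ultimately show ?thesis by blast
  qed
  hence "sub_dim n (Z S0 ?N) = 0"
    using V.dim_zero_vs unfolding sub_dim_def V.span_empty by (simp only:)
  hence "sub_dim (d S0) (restr (J S0) n ` ?N) = sub_dim n ?N" using rn(1)[OF N, where T = S0] by simp
  also have "\<dots> = flag_rank n F S0 k" using rn(1)[OF W, where T = S1] R[of S1] sum dW by simp
  finally have "restr (J S0) n ` ?N = restr (J S0) n ` W"
    using sub_dim_mono(2)[OF rn(3)[OF N, where T = S0] rn(3)[OF W, where T = S0] image_mono[OF NW]] R[of S0] by simp
  have "restr (J S) n ` ?N = restr (J S) n ` W"
  proof
    show "restr (J S) n ` ?N \<subseteq> restr (J S) n ` W" using NW by auto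
    show "restr (J S) n ` W \<subseteq> restr (J S) n ` ?N"
    proof (rule image_subsetI)
      fix w assume "w \<in> W"
      then obtain w' where w': "w' \<in> ?N" "restr (J S0) n w = restr (J S0) n w'"
        using \<open>restr (J S0) n ` ?N = restr (J S0) n ` W\<close> by (metis (no_types, lifting) imageE imageI)
      hence "restr (J S) n w = restr (J S) n w'" using S unfolding restr_eq_iff J_def by auto
      thus "restr (J S) n w \<in> restr (J S) n ` ?N" using w'(1) by auto
    qed
  qed
  moreover have "Z S ?N = Z (S \<union> S1) W" unfolding Z_def J_def by auto
  ultimately show ?thesis
    using rn(1)[OF N, where T = S] rn(1)[OF W, where T = "S \<union> S1"] rn(1)[OF W, where T = S1] R dW by simp
qed

lemma set_cyc_list: "r \<in> {1..n} \<Longrightarrow> set (cyc_list n r) = {1..n}"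
  unfolding cyc_list_def by auto

lemma distinct_cyc_list: "distinct (cyc_list n r)"
  unfolding cyc_list_def by auto

lemma cyc_ivl_take:
  assumes "r \<in> {1..n}" "i \<in> {1..n}"
  shows "\<exists>m. cyc_ivl n r i = set (take m (cyc_list n r))"
proof (cases "r \<le> i")
  case True
  have "cyc_ivl n r i = set (take (i - r) (cyc_list n r))"
    using True assms unfolding cyc_ivl_def cyc_list_def by (auto simp: take_upt simp del: upt_Suc)
  thus ?thesis by blast
next
  case False
  have "cyc_ivl n r i = set (take (Suc n - r + (i - 1)) (cyc_list n r))"
    using False assms unfolding cyc_ivl_def cyc_list_def by (auto simp: take_upt simp del: upt_Suc)
  thus ?thesis by blast
qed

lemma cyc_subset_le_card:
  assumes le: "cyc_subset_le n r A B" and r: "r \<in> {1..n}" and i: "i \<in> {1..n}"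
  shows "card (B \<inter> cyc_ivl n r i) \<le> card (A \<inter> cyc_ivl n r i)"
proof -
  let ?L = "cyc_list n r"
  obtain m where m: "cyc_ivl n r i = set (take m ?L)" using cyc_ivl_take[OF r i] by auto
  let ?f = "\<lambda>C xs. filter (\<lambda>x. x \<in> C) xs"
  have app: "?f C ?L = ?f C (take m ?L) @ ?f C (drop m ?L)" for C
    by (metis append_take_drop_id filter_append)
  have c: "card (C \<inter> cyc_ivl n r i) = length (?f C (take m ?L))" for C
  proof -
    have "C \<inter> cyc_ivl n r i = set (?f C (take m ?L))" using m by auto
    thus ?thesis using distinct_card[of "?f C (take m ?L)"] distinct_cyc_list[of n r] by simp
  qed
  have disj: "set (take m ?L) \<inter> set (drop m ?L) = {}"
    using distinct_cyc_list[of n r] set_take_disj_set_drop_if_distinct by blast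
  show ?thesis
  proof (rule ccontr)
    let ?a = "length (?f A (take m ?L))"
    assume "\<not> ?thesis"
    hence lt: "?a < length (?f B (take m ?L))" using c by simp
    have la: "list_all2 (\<lambda>x y. cyc_less n r x y \<or> x = y) (?f A ?L) (?f B ?L)"
      using le unfolding cyc_subset_le_def .
    have lb: "?a < length (?f B ?L)" using lt unfolding app[of B] by simp
    hence lA: "?a < length (?f A ?L)" using list_all2_lengthD[OF la] by simp
    define x y where "x = ?f A ?L ! ?a" and "y = ?f B ?L ! ?a"
    have "x \<in> set (?f A (drop m ?L))"
      using lA nth_mem[of 0 "?f A (drop m ?L)"] unfolding x_def app[of A] by (simp add: nth_append del: filter_set set_filter)
    hence x: "x \<in> set (drop m ?L)" by auto
    have "y \<in> set (?f B (take m ?L))"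
      using nth_mem[OF lt] lt unfolding y_def app[of B] by (simp add: nth_append del: filter_set set_filter)
    hence y: "y \<in> set (take m ?L)" by auto
    have "cyc_less n r x y \<or> x = y" using list_all2_nthD2[OF la lb] unfolding x_def y_def by simp
    moreover have "x \<noteq> y" using x y disj by auto
    ultimately obtain p q where pq: "p < q" "q < length ?L" "?L ! p = x" "?L ! q = y"
      unfolding cyc_less_def by auto
    obtain q' where q': "q' < m" "q' < length ?L" "?L ! q' = y" using y by (auto simp: in_set_conv_nth)
    hence "q = q'" using pq distinct_cyc_list[of n r] by (metis nth_eq_iff_index_eq)
    hence "x \<in> set (take m ?L)" using pq q' by (auto simp: in_set_conv_nth intro!: exI[of _ p])
    thus False using x disj by auto
  qed
qed

lemma cyc_ivl_mem: "x \<in> cyc_ivl n a b \<longleftrightarrow> (if a \<le> b then a \<le> x \<and> x < b else a \<le> x \<and> x \<le> n \<or> 1 \<le> x \<and> x < b)"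
  unfolding cyc_ivl_def by auto

lemma cyc_ivl_split:
  assumes "p \<in> {1..n}" "q \<in> {1..n}" "p \<noteq> q" "i \<in> cyc_ivl n p q"
  shows "cyc_ivl n q i = cyc_ivl n p i \<union> cyc_ivl n q p" "cyc_ivl n p i \<inter> cyc_ivl n q p = {}"
      "cyc_ivl n p i \<subseteq> cyc_ivl n p q"
    and "i \<noteq> p \<Longrightarrow> cyc_ivl n i p = cyc_ivl n i q \<union> cyc_ivl n q p"
      "i \<noteq> p \<Longrightarrow> cyc_ivl n i q \<inter> cyc_ivl n q p = {}" "i \<noteq> p \<Longrightarrow> cyc_ivl n i q \<subseteq> cyc_ivl n p q"
proof -
  have cs: "p < q \<and> p \<le> i \<and> i < q \<or> q < p \<and> p \<le> i \<and> i \<le> n \<or> q < p \<and> 1 \<le> i \<and> i < q"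
    using assms(3,4) unfolding cyc_ivl_mem by (auto split: if_splits)
  note s = cyc_ivl_def set_eq_iff subset_iff
  have b: "1 \<le> p" "p \<le> n" "1 \<le> q" "q \<le> n" using assms by auto
  show "cyc_ivl n q i = cyc_ivl n p i \<union> cyc_ivl n q p" using cs b by (elim disjE) (auto simp: s)
  show "cyc_ivl n p i \<inter> cyc_ivl n q p = {}" using cs b by (elim disjE) (auto simp: s)
  show "cyc_ivl n p i \<subseteq> cyc_ivl n p q" using cs b by (elim disjE) (auto simp: s)
  assume ne: "i \<noteq> p"
  show "cyc_ivl n i p = cyc_ivl n i q \<union> cyc_ivl n q p" using cs b ne by (elim disjE) (auto simp: s)
  show "cyc_ivl n i q \<inter> cyc_ivl n q p = {}" using cs b ne by (elim disjE) (auto simp: s)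
  show "cyc_ivl n i q \<subseteq> cyc_ivl n p q" using cs b ne by (elim disjE) (auto simp: s)
qed

lemma tilted_rank_conds_indep_aux:
  fixes b c :: "nat \<Rightarrow> nat"
  assumes u: "u permutes {1..n}" and v: "v permutes {1..n}"
    and b: "b \<in> {1..n} \<rightarrow> {1..n}" and c: "c \<in> {1..n} \<rightarrow> {1..n}"
    and ub: "tilted_le n b u v" and uc: "tilted_le n c u v"
    and F: "F \<in> Fl n" and cond: "tilted_rank_conds n b u v F"
  shows "tilted_rank_conds n c u v F"
  unfolding tilted_rank_conds_def
proof (intro ballI)
  fix i k assume i: "i \<in> {1..n}" and k: "k \<in> {1..n}"
  define A B p q where "A = u ` {1..k}" and "B = v ` {1..k}" and "p = b k" and "q = c k"
  define R where "R S = flag_rank n F S k" for S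
  have p: "p \<in> {1..n}" and q: "q \<in> {1..n}" using b c k unfolding p_def q_def by auto
  have kn: "k \<le> n" using k by simp
  have im: "w ` {1..k} \<subseteq> {1..n} \<and> card (w ` {1..k}) = k" if "w permutes {1..n}" for w :: "nat \<Rightarrow> nat"
  proof
    have "{1..k} \<subseteq> {1..n}" using kn by simp
    thus "w ` {1..k} \<subseteq> {1..n}" using permutes_image[OF that] by blast
    show "card (w ` {1..k}) = k" using card_image[OF permutes_inj_on[OF that], of "{1..k}"] by simp
  qed
  have A: "A \<subseteq> {1..n}" "card A = k" and B: "B \<subseteq> {1..n}" "card B = k"
    unfolding A_def B_def using im[OF u] im[OF v] by blast+
  have fin: "finite A" "finite B" using A B finite_subset by blast+
  have Rp: "R (cyc_ivl n p j) = card (A \<inter> cyc_ivl n p j)" "R (cyc_ivl n j p) = card (B \<inter> cyc_ivl n j p)"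
    if "j \<in> {1..n}" for j
    using cond that k unfolding tilted_rank_conds_def R_def A_def B_def p_def by auto
  have R0: "R {} = 0" unfolding R_def using flag_rank_empty[OF F kn] .
  have goal: "R (cyc_ivl n q i) = card (A \<inter> cyc_ivl n q i) \<and> R (cyc_ivl n i q) = card (B \<inter> cyc_ivl n i q)"
  proof (cases "p = q \<or> i = q")
    case True
    thus ?thesis using Rp[OF i] R0 by (auto simp: cyc_ivl_def)
  next
    case False
    let ?P = "cyc_ivl n p q" and ?Q = "cyc_ivl n q p"
    have PQ: "?P \<union> ?Q = {1..n}" "?P \<inter> ?Q = {}" using False p q by (auto simp: cyc_ivl_def)
    have cA: "card (A \<inter> X \<union> A \<inter> Y) = card (A \<inter> X) + card (A \<inter> Y)" if "X \<inter> Y = {}" for X Y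
      using that fin by (intro card_Un_disjoint) auto
    have cB: "card (B \<inter> X \<union> B \<inter> Y) = card (B \<inter> X) + card (B \<inter> Y)" if "X \<inter> Y = {}" for X Y
      using that fin by (intro card_Un_disjoint) auto
    have "A \<inter> ?P \<union> A \<inter> ?Q = A" "B \<inter> ?P \<union> B \<inter> ?Q = B" using PQ A B by auto
    hence sums: "card (A \<inter> ?P) + card (A \<inter> ?Q) = k" "card (B \<inter> ?P) + card (B \<inter> ?Q) = k"
      using cA[OF PQ(2)] cB[OF PQ(2)] A B by auto
    have "cyc_subset_le n p A B" "cyc_subset_le n q A B"
      using ub uc k unfolding tilted_le_def A_def B_def p_def q_def by auto
    hence "card (B \<inter> ?P) \<le> card (A \<inter> ?P)" "card (B \<inter> ?Q) \<le> card (A \<inter> ?Q)"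
      using cyc_subset_le_card p q by blast+
    hence eqP: "card (A \<inter> ?P) = card (B \<inter> ?P)" and eqQ: "card (A \<inter> ?Q) = card (B \<inter> ?Q)"
      using sums by auto
    have RP: "R ?P = card (A \<inter> ?P)" and RQ: "R ?Q = card (A \<inter> ?Q)" using Rp[OF q] eqQ by auto
    have spl: "R (S \<union> ?Q) = R S + R ?Q" if "S \<subseteq> ?P" for S
      using flag_rank_split[OF F kn PQ(1) _ that] RP RQ sums unfolding R_def by simp
    have spl': "R (S \<union> ?P) = R S + R ?P" if "S \<subseteq> ?Q" for S
      using flag_rank_split[OF F kn _ _ that, of ?P] PQ(1) RP RQ sums unfolding R_def by (simp add: Un_commute)
    show ?thesis
    proof (cases "i \<in> ?P")
      case iP: True
      have 1: "cyc_ivl n q i = cyc_ivl n p i \<union> ?Q" "cyc_ivl n p i \<inter> ?Q = {}" "cyc_ivl n p i \<subseteq> ?P"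
        using cyc_ivl_split[OF p q _ iP] False by auto
      have a: "R (cyc_ivl n q i) = card (A \<inter> cyc_ivl n q i)"
        using spl[OF 1(3)] cA[OF 1(2)] RQ Rp(1)[OF i] unfolding 1(1) Int_Un_distrib by simp
      have "R (cyc_ivl n i q) = card (B \<inter> cyc_ivl n i q)"
      proof (cases "i = p")
        case True thus ?thesis using RP eqP by simp
      next
        case ip: False
        have 2: "cyc_ivl n i p = cyc_ivl n i q \<union> ?Q" "cyc_ivl n i q \<inter> ?Q = {}" "cyc_ivl n i q \<subseteq> ?P"
          using cyc_ivl_split[OF p q _ iP] ip False by auto
        show ?thesis
          using spl[OF 2(3)] cB[OF 2(2)] RQ eqQ Rp(2)[OF i] unfolding 2(1) Int_Un_distrib by simp
      qed
      thus ?thesis using a by simp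
    next
      case False
      hence iQ: "i \<in> ?Q" and ne: "q \<noteq> p" "i \<noteq> q" using \<open>\<not> (p = q \<or> i = q)\<close> PQ(1) i by blast+
      have 1: "cyc_ivl n p i = cyc_ivl n q i \<union> ?P" "cyc_ivl n q i \<inter> ?P = {}" "cyc_ivl n q i \<subseteq> ?Q"
        using cyc_ivl_split[OF q p ne(1) iQ] ne by simp_all
      have 2: "cyc_ivl n i q = cyc_ivl n i p \<union> ?P" "cyc_ivl n i p \<inter> ?P = {}" "cyc_ivl n i p \<subseteq> ?Q"
        using cyc_ivl_split[OF q p ne(1) iQ] ne by simp_all
      have "R (cyc_ivl n q i) = card (A \<inter> cyc_ivl n q i)"
        using spl'[OF 1(3)] cA[OF 1(2)] RP Rp(1)[OF i] unfolding 1(1) Int_Un_distrib by simp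
      moreover have "R (cyc_ivl n i q) = card (B \<inter> cyc_ivl n i q)"
        using spl'[OF 2(3)] cB[OF 2(2)] RP eqP Rp(2)[OF i] unfolding 2(1) Int_Un_distrib by simp
      ultimately show ?thesis by simp
    qed
  qed
  show "flag_rank n F (cyc_ivl n (c k) i) k = card (u ` {1..k} \<inter> cyc_ivl n (c k) i) \<and>
        flag_rank n F (cyc_ivl n i (c k)) k = card (v ` {1..k} \<inter> cyc_ivl n i (c k))"
    using goal unfolding R_def A_def B_def q_def .
qed

lemma tilted_richardson_eq:
  assumes "u permutes {1..n}" "v permutes {1..n}" "b \<in> {1..n} \<rightarrow> {1..n}" "tilted_le n b u v"
  shows "tilted_richardson n u v = {F \<in> Fl n. tilted_rank_conds n b u v F}"
  unfolding tilted_richardson_def using tilted_rank_conds_indep_aux[OF assms(1,2)] assms by blast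

end

(*
  For a flag F the maps r_k S = rank_S(F_k) are matroid rank functions, and the matroid of F_(k-1) is a
  quotient of that of F_k; nothing else about F is needed.

  (1) Take b = a.  The rank conditions say that u[k] and v[k] are the greedy bases of r_k for <_(a_k)
  and its reverse, and exchanging u_k for a smaller (v_k for a larger) element violates the rank of a
  cyclic interval starting (ending) at a_k.

  (2) The inequality >= in the rank conditions holds because u[k] and v[k] are bases.  The inequality <=
  goes by induction on k.  If u_k is not in P = [a_k, i)_c, the vanishing minors put P into the closure
  of u[k-1] in r_k, and the quotient property gives r_k P <= r_(k-1) P; otherwise
  r_k P <= r_(k-1) P + 1 suffices.  This uses the conditions for r_(k-1) at a_k rather than a_(k-1):
  the cardinality condition makes r_(k-1) split over [a_(k-1), a_k)_c and its complement, which lets the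
  starting point move.
*)

theory Submission
  imports Defs
begin

section \<open>Matroid rank functions\<close>

locale rank_function =
  fixes E :: "'a set" and r :: "'a set \<Rightarrow> nat"
  assumes finite_ground: "finite E"
    and rank_le_card: "X \<subseteq> E \<Longrightarrow> r X \<le> card X"
    and rank_mono: "X \<subseteq> Y \<Longrightarrow> Y \<subseteq> E \<Longrightarrow> r X \<le> r Y"
    and rank_submod: "X \<subseteq> E \<Longrightarrow> Y \<subseteq> E \<Longrightarrow> r (X \<union> Y) + r (X \<inter> Y) \<le> r X + r Y"
begin

lemma rank_Un_le: "X \<subseteq> E \<Longrightarrow> Y \<subseteq> E \<Longrightarrow> r (X \<union> Y) \<le> r X + r Y"
  using rank_submod[of X Y] by simp

text \<open>Subadditivity over \<open>I \<inter> X\<close> and \<open>I - X\<close>: if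
  \<open>I \<inter> X\<close> fell short of full rank, so would \<open>I\<close>. It supplies the
  lower bounds in the rank conditions and, read backwards, the dependence of sets that meet an
  interval too often.\<close>

lemma card_Int_le_rank:
  assumes "I \<subseteq> E" "r I = card I" "X \<subseteq> E"
  shows "card (I \<inter> X) \<le> r X"
proof -
  have "I = I \<inter> X \<union> (I - X)" by auto
  hence "r I \<le> r (I \<inter> X) + r (I - X)" using rank_Un_le[of "I \<inter> X" "I - X"] assms by auto
  moreover have "r (I - X) \<le> card (I - X)" using rank_le_card[of "I - X"] assms by auto
  moreover have "r (I \<inter> X) \<le> r X" using rank_mono[of "I \<inter> X" X] assms by auto
  moreover have "card I = card (I \<inter> X) + card (I - X)"
    using assms finite_ground finite_subset by (metis card_Int_Diff)
  ultimately show ?thesis using assms(2) by linarith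
qed

text \<open>The last hypothesis puts \<open>P\<close> into the closure of \<open>W\<close>. Elements
  are added one at a time, and submodularity keeps the rank from growing.\<close>

lemma rank_Un_closure:
  assumes "W \<subseteq> E" "P \<subseteq> E" and cl: "\<And>y. y \<in> P \<Longrightarrow> r (insert y W) \<le> r W"
  shows "r (W \<union> P) \<le> r W"
proof -
  have "finite P" using assms finite_ground finite_subset by blast
  from this assms(2) cl show ?thesis
  proof (induction P rule: finite_induct)
    case (insert y P)
    have "r ((W \<union> P) \<union> insert y W) + r ((W \<union> P) \<inter> insert y W) \<le> r (W \<union> P) + r (insert y W)"
      using insert.prems assms(1) by (intro rank_submod) auto
    moreover have "r W \<le> r ((W \<union> P) \<inter> insert y W)"
      using insert.prems assms(1) by (intro rank_mono) auto
    moreover have "(W \<union> P) \<union> insert y W = W \<union> insert y P" by auto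
    moreover have "r (W \<union> P) \<le> r W" "r (insert y W) \<le> r W" using insert by auto
    ultimately show ?case by simp
  qed simp
qed

text \<open>The rank hypothesis makes the matroid the direct sum of its restrictions to
  \<open>P\<close> and \<open>Q\<close>. Apply submodularity to \<open>X \<union> Q\<close> and
  \<open>P\<close>, whose union is \<open>E\<close> and whose intersection is
  \<open>X\<close>.\<close>

lemma rank_direct_sum:
  assumes "P \<union> Q = E" "P \<inter> Q = {}" "r P + r Q \<le> r E" "X \<subseteq> P"
  shows "r X + r Q \<le> r (X \<union> Q)"
proof -
  have "(X \<union> Q) \<union> P = E" "(X \<union> Q) \<inter> P = X" "X \<union> Q \<subseteq> E" "P \<subseteq> E" using assms by auto
  thus ?thesis using rank_submod[of "X \<union> Q" P] assms(3) by simp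
qed

text \<open>Along the list the rank rises exactly at the elements of \<open>A\<close>, so
  \<open>A\<close> is what the greedy algorithm picks. A rise caused by \<open>x\<close> over the
  whole prefix forces, by submodularity, a rise over the smaller set
  \<open>A \<inter> set xs\<close>.\<close>

lemma greedy_independent:
  assumes "distinct xs" "set xs \<subseteq> E"
    and "\<And>m. m \<le> length xs \<Longrightarrow> r (set (take m xs)) = card (A \<inter> set (take m xs))"
  shows "card (A \<inter> set xs) \<le> r (A \<inter> set xs)"
  using assms
proof (induction xs rule: rev_induct)
  case (snoc x xs)
  have eq: "r (set (take m xs)) = card (A \<inter> set (take m xs))" if "m \<le> length xs" for m
    using snoc.prems(3)[of m] that by simp
  have IH: "card (A \<inter> set xs) \<le> r (A \<inter> set xs)" using snoc.IH snoc.prems eq by simp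
  show ?case
  proof (cases "x \<in> A")
    case True
    let ?X = "set xs" and ?Y = "insert x (A \<inter> set xs)"
    have "r (?X \<union> ?Y) + r (?X \<inter> ?Y) \<le> r ?X + r ?Y" using snoc.prems by (intro rank_submod) auto
    moreover have "?X \<union> ?Y = set (xs @ [x])" "?X \<inter> ?Y = A \<inter> set xs" "?Y = A \<inter> set (xs @ [x])"
      using True snoc.prems(1) by auto
    moreover have "r (set (xs @ [x])) = card ?Y"
      using snoc.prems(3)[of "length (xs @ [x])"] True by simp
    moreover have "r ?X = card (A \<inter> set xs)" using eq[of "length xs"] by simp
    ultimately show ?thesis using IH by simp
  qed (use IH in simp)
qed simp

end

section \<open>Cyclic intervals\<close>

lemma length_cyc_list: "r \<in> {1..n} \<Longrightarrow> length (cyc_list n r) = n"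
  unfolding cyc_list_def by auto

lemma cyc_less_nth:
  assumes "m < length (cyc_list n r)"
  shows "cyc_less n r x (cyc_list n r ! m) \<longleftrightarrow> (\<exists>i<m. cyc_list n r ! i = x)"
  using assms nth_eq_iff_index_eq[OF distinct_cyc_list[of n r]]
  unfolding cyc_less_def by metis

text \<open>Trades list positions for inequalities, so that later comparisons are linear
  arithmetic.\<close>

lemma cyc_less_iff:
  assumes r: "r \<in> {1..n}"
  shows "cyc_less n r x y \<longleftrightarrow> x \<in> {1..n} \<and> y \<in> {1..n} \<and>
    (r \<le> x \<and> x < y \<or> x < y \<and> y < r \<or> y < r \<and> r \<le> x)"
proof -
  let ?L = "cyc_list n r"
  \<comment> \<open>The zero-based index of \<open>x\<close>: the block from \<open>r\<close> to
    \<open>n\<close> has length \<open>Suc n - r\<close>, and a value below \<open>r\<close> follows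
    it at offset \<open>x - 1\<close>.\<close>
  define pos where "pos x = (if r \<le> x then x - r else Suc n - r + (x - 1))" for x
  have nth: "?L ! i = (if i < Suc n - r then r + i else i - (Suc n - r) + 1)" if "i < n" for i
    using that r unfolding cyc_list_def by (auto simp: nth_append simp del: upt_Suc)
  have pos: "pos x < n \<and> ?L ! pos x = x" if "x \<in> {1..n}" for x
    using that r nth[of "pos x"] unfolding pos_def by auto
  have mem: "?L ! i \<in> {1..n}" if "i < n" for i
    using that nth_mem[of i ?L] set_cyc_list[OF r] length_cyc_list[OF r] by auto
  have nth_pos: "pos (?L ! i) = i" if "i < n" for i
    using pos[OF mem[OF that]] that length_cyc_list[OF r]
      nth_eq_iff_index_eq[OF distinct_cyc_list[of n r], of "pos (?L ! i)" i] by simp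
  have "cyc_less n r x y \<longleftrightarrow> x \<in> {1..n} \<and> y \<in> {1..n} \<and> pos x < pos y"
  proof
    assume "cyc_less n r x y"
    then obtain i j where "i < j" "j < n" "?L ! i = x" "?L ! j = y"
      unfolding cyc_less_def length_cyc_list[OF r] by blast
    thus "x \<in> {1..n} \<and> y \<in> {1..n} \<and> pos x < pos y"
      using mem[of i] mem[of j] nth_pos[of i] nth_pos[of j] by auto
  next
    assume "x \<in> {1..n} \<and> y \<in> {1..n} \<and> pos x < pos y"
    thus "cyc_less n r x y"
      unfolding cyc_less_def length_cyc_list[OF r]
      using pos[of x] pos[of y] by (intro exI[of _ "pos x"] exI[of _ "pos y"]) simp
  qed
  thus ?thesis using r unfolding pos_def by auto
qed

lemma cyc_ivl_initial:
  assumes "r \<in> {1..n}" "i \<in> {1..n}"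
  shows "cyc_ivl n r i = {x. cyc_less n r x i}"
  using assms by (auto simp: cyc_less_iff cyc_ivl_mem split: if_splits)

text \<open>The case \<open>i = r\<close> has to be excluded: the interval is then empty, whereas
  the final segment from \<open>r\<close> is everything.\<close>

lemma cyc_ivl_final:
  assumes "r \<in> {1..n}" "i \<in> {1..n}" "i \<noteq> r"
  shows "cyc_ivl n i r = insert i {x. cyc_less n r i x}"
  using assms by (auto simp: cyc_less_iff cyc_ivl_mem split: if_splits)

lemma cyc_ivl_subset: "p \<in> {1..n} \<Longrightarrow> q \<in> {1..n} \<Longrightarrow> cyc_ivl n p q \<subseteq> {1..n}"
  by (auto simp: cyc_ivl_def)

text \<open>Links the list prefixes of \<open>greedy_independent\<close> to the intervals in the
  rank conditions. The full list is left out because no interval starting at \<open>r\<close> is the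
  whole ground set.\<close>

lemma set_take_cyc_list:
  assumes "r \<in> {1..n}" "m < n"
  shows "cyc_list n r ! m \<in> {1..n}"
    and "set (take m (cyc_list n r)) = cyc_ivl n r (cyc_list n r ! m)"
proof -
  have m: "m < length (cyc_list n r)" using assms length_cyc_list by simp
  show mem: "cyc_list n r ! m \<in> {1..n}" using nth_mem[OF m] set_cyc_list[OF assms(1)] by simp
  show "set (take m (cyc_list n r)) = cyc_ivl n r (cyc_list n r ! m)"
    unfolding cyc_ivl_initial[OF assms(1) mem] cyc_less_nth[OF m] nth_image[OF less_imp_le[OF m], symmetric]
    by auto
qed

lemma set_drop_cyc_list:
  assumes "r \<in> {1..n}" "0 < m" "m < n"
  shows "set (drop m (cyc_list n r)) = cyc_ivl n (cyc_list n r ! m) r"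
proof -
  have m: "m < length (cyc_list n r)" using assms length_cyc_list by simp
  have "cyc_list n r ! 0 = r" using assms unfolding cyc_list_def by (auto simp: nth_append simp del: upt_Suc)
  hence ne: "cyc_list n r ! m \<noteq> r"
    using nth_eq_iff_index_eq[OF distinct_cyc_list m order.strict_trans[OF assms(2) m]] assms(2) by simp
  have "set (take m (cyc_list n r)) \<union> set (drop m (cyc_list n r)) = {1..n}"
    unfolding set_append[symmetric] append_take_drop_id by (rule set_cyc_list[OF assms(1)])
  moreover have "set (take m (cyc_list n r)) \<inter> set (drop m (cyc_list n r)) = {}"
    by (rule set_take_disj_set_drop_if_distinct[OF distinct_cyc_list order_refl])
  moreover have "cyc_ivl n r i \<union> cyc_ivl n i r = {1..n}" "cyc_ivl n r i \<inter> cyc_ivl n i r = {}"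
    if "i \<in> {1..n}" "i \<noteq> r" for i using that assms(1) by (auto simp: cyc_ivl_def)
  note this[OF set_take_cyc_list(1)[OF assms(1,3)] ne]
  ultimately show ?thesis unfolding set_take_cyc_list(2)[OF assms(1,3)] by blast
qed

section \<open>The rank functions of a flag\<close>

text \<open>The kernel of the restriction of \<open>W\<close> to the rows in \<open>S\<close>. Ranks
  become codimensions of such kernels, which can be compared for different row sets and for
  different steps of the flag.\<close>

definition vanish :: "nat \<Rightarrow> nat set \<Rightarrow> complex vec set \<Rightarrow> complex vec set" where
  "vanish n S W = {x \<in> W. \<forall>i<n. Suc i \<in> S \<longrightarrow> x $ i = 0}"

lemma vanish_vanish: "vanish n T (vanish n S W) = vanish n (S \<union> T) W"
  unfolding vanish_def by auto

lemma subspace_vanish: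
  "VectorSpace.subspace class_ring W (Cvec n) \<Longrightarrow> VectorSpace.subspace class_ring (vanish n S W) (Cvec n)"
  using restr_rank_nullity(2)[of W n "{i. Suc i \<in> S}"] unfolding vanish_def by simp

text \<open>By rank-nullity, passing from \<open>S\<close> to \<open>T\<close> loses the dimension
  of the image of \<open>vanish n S Y\<close> in the rows \<open>T\<close>, and this image grows
  with \<open>Y\<close>. The one inequality yields both submodularity and the quotient
  property.\<close>

lemma sub_dim_vanish_restr:
  assumes X: "VectorSpace.subspace class_ring X (Cvec n)" and W: "VectorSpace.subspace class_ring W (Cvec n)"
    and "X \<subseteq> W" "S \<subseteq> T"
  shows "sub_dim n (vanish n S X) + sub_dim n (vanish n T W)
    \<le> sub_dim n (vanish n S W) + sub_dim n (vanish n T X)"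
proof -
  let ?I = "{i. Suc i \<in> T}"
  let ?m = "card {i. i < n \<and> i \<in> ?I}"
  have rn: "sub_dim ?m (restr ?I n ` vanish n S Y) + sub_dim n (vanish n T Y) = sub_dim n (vanish n S Y)"
    and sub: "VectorSpace.subspace class_ring (restr ?I n ` vanish n S Y) (Cvec ?m)"
    if "VectorSpace.subspace class_ring Y (Cvec n)" for Y
  proof -
    have "{x \<in> vanish n S Y. \<forall>i<n. i \<in> ?I \<longrightarrow> x $ i = 0} = vanish n T Y"
      using assms(4) unfolding vanish_def by auto
    thus "sub_dim ?m (restr ?I n ` vanish n S Y) + sub_dim n (vanish n T Y) = sub_dim n (vanish n S Y)"
      using restr_rank_nullity(1)[OF subspace_vanish[OF that], of ?I S] by simp
    show "VectorSpace.subspace class_ring (restr ?I n ` vanish n S Y) (Cvec ?m)"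
      by (rule restr_rank_nullity(3)[OF subspace_vanish[OF that]])
  qed
  have "restr ?I n ` vanish n S X \<subseteq> restr ?I n ` vanish n S W"
    using assms(3) unfolding vanish_def by auto
  from sub_dim_mono(1)[OF sub[OF X] sub[OF W] this] show ?thesis
    using rn[OF X] rn[OF W] by linarith
qed

lemma sub_dim_le:
  assumes "VectorSpace.subspace class_ring W (Cvec n)"
  shows "sub_dim n W \<le> n"
proof -
  interpret V: vec_space "TYPE(complex)" n .
  obtain A where A: "A \<subseteq> W" "V.lin_indpt A" "card A = sub_dim n W"
    by (rule subspace_basis[OF assms])
  have "A \<subseteq> carrier_vec n" using A(1) subspace_carrier[OF assms] by (rule subset_trans)
  from V.li_le_dim(2)[OF V.fin_dim _ A(2)] this show ?thesis using A(3) V.dim_is_n by simp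
qed

context
  fixes n k :: nat and F :: "nat \<Rightarrow> complex vec set"
  assumes F: "F \<in> Fl n" and k: "k \<le> n"
begin

lemma Fl_subspace: "VectorSpace.subspace class_ring (F k) (Cvec n)" and Fl_dim: "sub_dim n (F k) = k"
  using F k unfolding Fl_def by auto

lemma flag_rank_restr:
  "flag_rank n F S k = sub_dim (card {i. i < n \<and> i \<in> {i. Suc i \<in> S}}) (restr {i. Suc i \<in> S} n ` F k)"
proof -
  obtain M where M: "represents n M F" using Fl_represented[OF F] by blast
  show ?thesis unfolding flag_rank_represents[OF M k] by (rule rank_rows_cols[OF M k])
qed

lemma flag_rank_vanish: "flag_rank n F S k + sub_dim n (vanish n S (F k)) = k"
  using restr_rank_nullity(1)[OF Fl_subspace, of "{i. Suc i \<in> S}"] Fl_dim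
  unfolding vanish_def flag_rank_restr by simp

lemma flag_rank_le: "flag_rank n F S k \<le> k"
  using flag_rank_vanish[of S] by simp

lemma rank_function_flag_rank: "rank_function {1..n} (\<lambda>S. flag_rank n F S k)"
proof
  fix X :: "nat set"
  assume X: "X \<subseteq> {1..n}"
  have "flag_rank n F X k \<le> card {i. i < n \<and> i \<in> {i. Suc i \<in> X}}"
    unfolding flag_rank_restr by (rule sub_dim_le[OF restr_rank_nullity(3)[OF Fl_subspace]])
  also have "\<dots> = card (Suc ` {i. i < n \<and> i \<in> {i. Suc i \<in> X}})" by (simp add: card_image)
  also have "\<dots> \<le> card X" using X finite_subset by (intro card_mono) auto
  finally show "flag_rank n F X k \<le> card X" .
next
  fix X Y :: "nat set"
  assume "X \<subseteq> Y"
  hence "vanish n Y (F k) \<subseteq> vanish n X (F k)" unfolding vanish_def by auto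
  from sub_dim_mono(1)[OF subspace_vanish[OF Fl_subspace] subspace_vanish[OF Fl_subspace] this]
  show "flag_rank n F X k \<le> flag_rank n F Y k"
    using flag_rank_vanish[of X] flag_rank_vanish[of Y] by linarith
next
  fix X Y :: "nat set"
  have "vanish n X (F k) \<subseteq> F k" unfolding vanish_def by auto
  \<comment> \<open>The smaller subspace is the kernel for \<open>X\<close>. It already vanishes on
    \<open>X \<inter> Y\<close>, and vanishing on \<open>Y\<close> as well cuts it down to the
    kernel for \<open>X \<union> Y\<close>.\<close>
  from sub_dim_vanish_restr[OF subspace_vanish[OF Fl_subspace] Fl_subspace this, of "X \<inter> Y" Y]
  show "flag_rank n F (X \<union> Y) k + flag_rank n F (X \<inter> Y) k \<le> flag_rank n F X k + flag_rank n F Y k"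
    using flag_rank_vanish[of X] flag_rank_vanish[of Y] flag_rank_vanish[of "X \<union> Y"]
      flag_rank_vanish[of "X \<inter> Y"]
    by (simp add: vanish_vanish Un_absorb2)
qed simp

lemma flag_rank_full: "flag_rank n F {1..n} k = k"
proof -
  interpret V: vec_space "TYPE(complex)" n .
  have sW: "F k \<subseteq> carrier_vec n" by (rule subspace_carrier[OF Fl_subspace])
  have "0\<^sub>v n \<in> F k"
    using Fl_subspace unfolding VectorSpace.subspace_def submodule_def by (auto simp: module_vec_simps)
  moreover have "x = 0\<^sub>v n" if "x \<in> vanish n {1..n} (F k)" for x
    using that sW unfolding vanish_def by (intro eq_vecI) auto
  ultimately have "vanish n {1..n} (F k) = {0\<^sub>v n}" unfolding vanish_def by auto
  hence "sub_dim n (vanish n {1..n} (F k)) = 0"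
    using V.dim_zero_vs unfolding sub_dim_def V.span_empty by (simp only:)
  thus ?thesis using flag_rank_vanish[of "{1..n}"] by simp
qed

end

text \<open>The kernel cannot shrink while the dimension of the subspace rises by one.\<close>

lemma flag_rank_Suc_le:
  assumes F: "F \<in> Fl n" and k: "k < n"
  shows "flag_rank n F S (Suc k) \<le> Suc (flag_rank n F S k)"
proof -
  have "F k \<subseteq> F (Suc k)" using F k unfolding Fl_def by auto
  hence "vanish n S (F k) \<subseteq> vanish n S (F (Suc k))" unfolding vanish_def by auto
  hence "sub_dim n (vanish n S (F k)) \<le> sub_dim n (vanish n S (F (Suc k)))"
    using F k by (intro sub_dim_mono(1) subspace_vanish Fl_subspace) auto
  thus ?thesis using flag_rank_vanish[OF F, of k S] flag_rank_vanish[OF F, of "Suc k" S] k by simp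
qed

text \<open>The quotient property: enlarging the row set from \<open>S\<close> to \<open>T\<close>
  gains at least as much rank in \<open>F (Suc k)\<close> as in \<open>F k\<close>.\<close>

lemma flag_rank_quotient:
  assumes F: "F \<in> Fl n" and k: "k < n" and "S \<subseteq> T"
  shows "flag_rank n F T k + flag_rank n F S (Suc k) \<le> flag_rank n F T (Suc k) + flag_rank n F S k"
proof -
  have "F k \<subseteq> F (Suc k)" using F k unfolding Fl_def by auto
  from sub_dim_vanish_restr[OF Fl_subspace[OF F] Fl_subspace[OF F] this assms(3)]
  show ?thesis
    using flag_rank_vanish[OF F, of k S] flag_rank_vanish[OF F, of "Suc k" S]
      flag_rank_vanish[OF F, of k T] flag_rank_vanish[OF F, of "Suc k" T] k by simp
qed

lemma flag_minor_eq_0_iff: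
  assumes "F \<in> Fl n" "I \<subseteq> {1..n}"
  shows "flag_minor n F I = 0 \<longleftrightarrow> flag_rank n F I (card I) \<noteq> card I"
proof -
  obtain M where "represents n M F" using Fl_represented[OF assms(1)] by auto
  from minor_rank[OF flag_mat_represents[OF this] assms(2)] show ?thesis
    unfolding flag_minor_def flag_rank_def .
qed

section \<open>Richardson varieties and Schubert cells\<close>

text \<open>Trading \<open>x\<close> outside \<open>P\<close> for \<open>y\<close> inside makes the
  set meet \<open>P\<close> in one element more than the rank of \<open>P\<close>, so the new set is
  dependent.\<close>

lemma flag_minor_exchange_0:
  assumes F: "F \<in> Fl n" and k: "k \<le> n" and W: "W \<subseteq> {1..n}" "Suc (card W) = k"
    and P: "P \<subseteq> {1..n}" "x \<notin> P" "flag_rank n F P k = card (insert x W \<inter> P)"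
    and y: "y \<in> P" "y \<notin> W"
  shows "flag_minor n F (W \<union> {y}) = 0"
proof -
  interpret rank_function "{1..n}" "\<lambda>S. flag_rank n F S k" by (rule rank_function_flag_rank[OF F k])
  have fin: "finite W" using W(1) finite_subset by blast
  have c: "card (W \<union> {y}) = k" using W y fin by simp
  have I: "W \<union> {y} \<subseteq> {1..n}" using W P y by auto
  have "(W \<union> {y}) \<inter> P = insert y (insert x W \<inter> P)" using P y by auto
  hence "card ((W \<union> {y}) \<inter> P) = Suc (card (insert x W \<inter> P))" using y P(2) fin by auto
  hence "flag_rank n F (W \<union> {y}) k \<noteq> card (W \<union> {y})"
    using card_Int_le_rank[OF I _ P(1)] P(3) by fastforce
  thus ?thesis using flag_minor_eq_0_iff[OF F I] c by simp
qed

text \<open>The inductive step of (2) for a single row set, with \<open>W\<close> the prefix of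
  length \<open>k\<close> and \<open>x\<close> the next value of the permutation.\<close>

lemma flag_rank_Suc_le_card:
  assumes F: "F \<in> Fl n" and k: "k < n" and W: "W \<subseteq> {1..n}" "card W = k" "flag_rank n F W k = k"
    and x: "x \<in> {1..n}" "x \<notin> W" "flag_minor n F (insert x W) \<noteq> 0"
    and P: "P \<subseteq> {1..n}" "flag_rank n F P k \<le> card (W \<inter> P)"
    and zero: "\<And>y. x \<notin> P \<Longrightarrow> y \<in> P \<Longrightarrow> y \<notin> W \<Longrightarrow> flag_minor n F (W \<union> {y}) = 0"
  shows "flag_rank n F P (Suc k) \<le> card (insert x W \<inter> P)"
proof (cases "x \<in> P")
  case True
  have "finite W" using W(1) finite_subset by blast
  hence "card (insert x W \<inter> P) = Suc (card (W \<inter> P))" using True x by auto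
  thus ?thesis using flag_rank_Suc_le[OF F k, of P] P(2) by simp
next
  case False
  have sk: "Suc k \<le> n" using k by simp
  interpret rank_function "{1..n}" "\<lambda>S. flag_rank n F S k"
    by (rule rank_function_flag_rank[OF F less_imp_le[OF k]])
  interpret S: rank_function "{1..n}" "\<lambda>S. flag_rank n F S (Suc k)"
    by (rule rank_function_flag_rank[OF F sk])
  have fin: "finite W" using W(1) finite_subset by blast
  have xW: "insert x W \<subseteq> {1..n}" "card (insert x W) = Suc k" using W x fin by auto
  have "card (insert x W \<inter> W) \<le> flag_rank n F W (Suc k)"
    using S.card_Int_le_rank[OF xW(1) _ W(1)] flag_minor_eq_0_iff[OF F xW(1)] x(3) xW(2) by simp
  moreover have "insert x W \<inter> W = W" by auto
  ultimately have rW: "flag_rank n F W (Suc k) = k" using S.rank_le_card[OF W(1)] W(2) by simp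
  \<comment> \<open>The vanishing minor makes \<open>W \<union> {y}\<close> dependent in
    \<open>F (Suc k)\<close>, while \<open>W\<close> keeps rank \<open>k\<close> there; hence
    \<open>y\<close> is in the closure of \<open>W\<close>.\<close>
  have "flag_rank n F (insert y W) (Suc k) \<le> flag_rank n F W (Suc k)" if y: "y \<in> P" for y
  proof (cases "y \<in> W")
    case False
    have I: "W \<union> {y} \<subseteq> {1..n}" "card (W \<union> {y}) = Suc k" using W y P fin False by auto
    hence "flag_rank n F (W \<union> {y}) (Suc k) \<noteq> Suc k"
      using flag_minor_eq_0_iff[OF F I(1)] zero[OF \<open>x \<notin> P\<close> y False] by simp
    thus ?thesis using flag_rank_le[OF F sk, of "W \<union> {y}"] rW by simp
  qed (simp add: insert_absorb)
  from S.rank_Un_closure[OF W(1) P(1) this]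
  have "flag_rank n F (W \<union> P) (Suc k) \<le> k" using rW by simp
  \<comment> \<open>The rank of \<open>W \<union> P\<close> thus does not grow from
    \<open>F k\<close> to \<open>F (Suc k)\<close>, and by the quotient property neither does that
    of its subset \<open>P\<close>.\<close>
  moreover have "k \<le> flag_rank n F (W \<union> P) k" using rank_mono[of W "W \<union> P"] W P by auto
  ultimately have "flag_rank n F P (Suc k) \<le> flag_rank n F P k"
    using flag_rank_quotient[OF F k, of P "W \<union> P"] by simp
  thus ?thesis using P(2) False by simp
qed

section \<open>Moving the starting point of the cyclic intervals\<close>

text \<open>Only the upper halves of the rank conditions, for one rank function and a free starting
  point \<open>p\<close>, so that \<open>p\<close> may move while \<open>k\<close> stays
  fixed.\<close>

definition cyc_rank_le ::
  "nat \<Rightarrow> (nat set \<Rightarrow> nat) \<Rightarrow> nat set \<Rightarrow> nat set \<Rightarrow> nat \<Rightarrow> bool" where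
  "cyc_rank_le n r A B p \<longleftrightarrow> (\<forall>i\<in>{1..n}.
     r (cyc_ivl n p i) \<le> card (A \<inter> cyc_ivl n p i) \<and> r (cyc_ivl n i p) \<le> card (B \<inter> cyc_ivl n i p))"

text \<open>Equality of the two cardinalities makes the matroid the direct sum of its restrictions to
  \<open>[p,q)\<^sub>c\<close> and \<open>[q,p)\<^sub>c\<close>.\<close>

lemma cyc_rank_le_shift:
  assumes "rank_function {1..n} r" and A: "A \<subseteq> {1..n}" "card A = r {1..n}"
    and B: "B \<subseteq> {1..n}" "card B = r {1..n}"
    and p: "p \<in> {1..n}" and q: "q \<in> {1..n}"
    and eq: "card (A \<inter> cyc_ivl n p q) = card (B \<inter> cyc_ivl n p q)"
    and le: "cyc_rank_le n r A B p"
  shows "cyc_rank_le n r A B q"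
proof (cases "p = q")
  case False
  interpret rank_function "{1..n}" r by (rule assms(1))
  let ?P = "cyc_ivl n p q" and ?Q = "cyc_ivl n q p"
  have PQ: "?P \<union> ?Q = {1..n}" "?P \<inter> ?Q = {}" using False p q by (auto simp: cyc_ivl_def)
  have fin: "finite A" "finite B" using A B finite_subset by blast+
  have card_Un: "card (C \<inter> (X \<union> Y)) = card (C \<inter> X) + card (C \<inter> Y)"
    if "X \<inter> Y = {}" "finite C" for C X Y :: "nat set"
    using that unfolding Int_Un_distrib by (intro card_Un_disjoint) auto
  have "A \<inter> (?P \<union> ?Q) = A" "B \<inter> (?P \<union> ?Q) = B" using PQ A B by auto
  hence sums: "card (A \<inter> ?P) + card (A \<inter> ?Q) = r {1..n}" "card (B \<inter> ?P) + card (B \<inter> ?Q) = r {1..n}"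
    using card_Un[OF PQ(2) fin(1)] card_Un[OF PQ(2) fin(2)] A B by auto
  have ip: "r (cyc_ivl n p i) \<le> card (A \<inter> cyc_ivl n p i)" "r (cyc_ivl n i p) \<le> card (B \<inter> cyc_ivl n i p)"
    if "i \<in> {1..n}" for i using le that unfolding cyc_rank_le_def by auto
  \<comment> \<open>The two ranks are at most \<open>card (A \<inter> ?P)\<close> and
    \<open>card (B \<inter> ?Q)\<close>, which add up to \<open>r {1..n}\<close> by
    \<open>eq\<close>; so equality holds throughout.\<close>
  have "r {1..n} \<le> r ?P + r ?Q" using rank_Un_le[of ?P ?Q] cyc_ivl_subset p q unfolding PQ(1) by auto
  hence rP: "r ?P = card (A \<inter> ?P)" "r ?P = card (B \<inter> ?P)"
    and rQ: "r ?Q = card (A \<inter> ?Q)" "r ?Q = card (B \<inter> ?Q)"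
    using ip[OF q] sums eq by auto
  note QP = PQ[unfolded Un_commute[of ?P] Int_commute[of ?P]]
  have dP: "r X + r ?Q \<le> r (X \<union> ?Q)" if "X \<subseteq> ?P" for X
    using rank_direct_sum[OF PQ _ that] rP rQ sums by simp
  have dQ: "r X + r ?P \<le> r (X \<union> ?P)" if "X \<subseteq> ?Q" for X
    using rank_direct_sum[OF QP _ that] rP rQ sums by simp
  show ?thesis unfolding cyc_rank_le_def
  proof (intro ballI)
    fix i assume i: "i \<in> {1..n}"
    note sub = cyc_ivl_subset[OF p q] cyc_ivl_subset[OF q p] cyc_ivl_subset[OF p i] cyc_ivl_subset[OF i p]
    show "r (cyc_ivl n q i) \<le> card (A \<inter> cyc_ivl n q i) \<and> r (cyc_ivl n i q) \<le> card (B \<inter> cyc_ivl n i q)"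
    proof (cases "i \<in> ?P")
      case iP: True
      note s = cyc_ivl_split[OF p q False iP]
      \<comment> \<open>The interval from \<open>q\<close> to \<open>i\<close> arises by adding
        \<open>?Q\<close>, where subadditivity is enough. The one from \<open>i\<close> to
        \<open>q\<close> arises by removing \<open>?Q\<close>, which needs the direct sum. For
        \<open>i\<close> in \<open>?Q\<close> the two roles are swapped.\<close>
      have "r (cyc_ivl n q i) \<le> card (A \<inter> cyc_ivl n q i)"
        using rank_Un_le[OF sub(3,2)] ip(1)[OF i] rQ(1) card_Un[OF s(2) fin(1)] unfolding s(1) by simp
      moreover have "r (cyc_ivl n i q) \<le> card (B \<inter> cyc_ivl n i q)"
      proof (cases "i = p")
        case ne: False
        show ?thesis
          using dP[OF s(6)[OF ne]] ip(2)[OF i] rQ(2) card_Un[OF s(5)[OF ne] fin(2)]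
          unfolding s(4)[OF ne] by simp
      qed (use rP in simp)
      ultimately show ?thesis by simp
    next
      case False
      hence iQ: "i \<in> ?Q" using PQ i by blast
      note s = cyc_ivl_split[OF q p \<open>p \<noteq> q\<close>[symmetric] iQ]
      have "r (cyc_ivl n q i) \<le> card (A \<inter> cyc_ivl n q i)"
        using dQ[OF s(3)] ip(1)[OF i] rP(1) card_Un[OF s(2) fin(1)] unfolding s(1) by simp
      moreover have "r (cyc_ivl n i q) \<le> card (B \<inter> cyc_ivl n i q)"
      proof (cases "i = q")
        case True
        thus ?thesis using rank_le_card[of "{}"] by (simp add: cyc_ivl_def)
      next
        case ne: False
        show ?thesis
          using rank_Un_le[OF sub(4,1)] ip(2)[OF i] rP(2) card_Un[OF s(5)[OF ne] fin(2)]
          unfolding s(4)[OF ne] by simp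
      qed
      ultimately show ?thesis by simp
    qed
  qed
qed (use le in simp)

section \<open>Prefixes of permutations\<close>

lemma permutes_prefix:
  assumes "w permutes {1..n}" "k \<le> n"
  shows "w ` {1..k} \<subseteq> {1..n}" "card (w ` {1..k}) = k"
proof -
  have "{1..k} \<subseteq> {1..n}" using assms(2) by simp
  thus "w ` {1..k} \<subseteq> {1..n}" using permutes_image[OF assms(1)] by blast
  show "card (w ` {1..k}) = k" using card_image[OF permutes_inj_on[OF assms(1)], of "{1..k}"] by simp
qed

lemma image_atLeastAtMost_Suc: "w ` {1..Suc k} = insert (w (Suc k)) (w ` {1..k})"
  by (simp add: atLeastAtMostSuc_conv)

lemma flag_minor_perm_nonzero:
  assumes "F \<in> Fl n" "w permutes {1..n}"
  shows "flag_minor_perm n F w \<noteq> 0 \<longleftrightarrow> (\<forall>k\<in>{1..n}. flag_rank n F (w ` {1..k}) k = k)"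
  using flag_minor_eq_0_iff[OF assms(1) permutes_prefix(1)[OF assms(2)]] permutes_prefix(2)[OF assms(2)]
  unfolding flag_minor_perm_def by simp

section \<open>The two inclusions for a fixed flag\<close>

context
  fixes n :: nat and u v a :: "nat \<Rightarrow> nat" and F :: "nat \<Rightarrow> complex vec set"
  assumes u: "u permutes {1..n}" and v: "v permutes {1..n}" and a: "a \<in> {1..n} \<rightarrow> {1..n}"
    and F: "F \<in> Fl n"
begin

lemma tilted_rank_conds_imp_bases:
  assumes cond: "tilted_rank_conds n a u v F" and k: "k \<in> {1..n}"
  shows "flag_rank n F (u ` {1..k}) k = k" "flag_rank n F (v ` {1..k}) k = k"
proof -
  let ?L = "cyc_list n (a k)"
  have kn: "k \<le> n" and ak: "a k \<in> {1..n}" using a k by auto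
  interpret rank_function "{1..n}" "\<lambda>S. flag_rank n F S k" by (rule rank_function_flag_rank[OF F kn])
  have L: "set ?L = {1..n}" "distinct ?L" "length ?L = n"
    using set_cyc_list[OF ak] distinct_cyc_list length_cyc_list[OF ak] by auto
  have full: "w ` {1..k} \<inter> {1..n} = w ` {1..k}" "card (w ` {1..k}) = k"
    if "w permutes {1..n}" for w
    using permutes_prefix[OF that kn] by auto
  have "flag_rank n F (set (take m ?L)) k = card (u ` {1..k} \<inter> set (take m ?L))"
    if "m \<le> length ?L" for m
  proof (cases "m < n")
    case True
    thus ?thesis using cond k set_take_cyc_list[OF ak True] unfolding tilted_rank_conds_def by auto
  next
    case False
    hence "set (take m ?L) = {1..n}" using that L by simp
    thus ?thesis using full[OF u] flag_rank_full[OF F kn] by simp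
  qed
  from greedy_independent[OF L(2) _ this] have "k \<le> flag_rank n F (u ` {1..k}) k"
    using full[OF u] L(1) by simp
  thus "flag_rank n F (u ` {1..k}) k = k" using flag_rank_le[OF F kn, of "u ` {1..k}"] by simp
  have "flag_rank n F (set (take m (rev ?L))) k = card (v ` {1..k} \<inter> set (take m (rev ?L)))"
    if m: "m \<le> length (rev ?L)" for m
  proof -
    have t: "set (take m (rev ?L)) = set (drop (n - m) ?L)" using L(3) by (simp add: take_rev)
    \<comment> \<open>Prefixes of the reversed list are suffixes of \<open>?L\<close>; the empty one
      and the full one are outside the range of \<open>set_drop_cyc_list\<close>.\<close>
    consider "m = 0" | "m = n" | "0 < n - m" "n - m < n" using m L(3) by fastforce
    thus ?thesis
    proof cases
      case 1 thus ?thesis using flag_rank_empty[OF F kn] by simp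
    next
      case 2
      thus ?thesis using full[OF v] flag_rank_full[OF F kn] L by simp
    next
      case 3
      thus ?thesis using cond k set_take_cyc_list(1)[OF ak 3(2)] set_drop_cyc_list[OF ak 3]
        unfolding t tilted_rank_conds_def by auto
    qed
  qed
  from greedy_independent[OF _ _ this] have "k \<le> flag_rank n F (v ` {1..k}) k"
    using full[OF v] L by simp
  thus "flag_rank n F (v ` {1..k}) k = k" using flag_rank_le[OF F kn, of "v ` {1..k}"] by simp
qed

lemma tilted_rank_conds_imp_schubert:
  assumes cond: "tilted_rank_conds n a u v F"
  shows "F \<in> schubert_X n v a \<inter> schubert_Omega n u a"
proof -
  \<comment> \<open>Serves both diagrams: \<open>P\<close> will be a cyclic interval at
    \<open>a k\<close> that contains \<open>w i\<close> but not \<open>w k\<close>.\<close>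
  have minor0: "flag_minor n F (w ` {1..<k} \<union> {w i}) = 0"
    if w: "w permutes {1..n}" and ik: "i \<in> {1..n}" "k \<in> {1..n}" "k < i"
      and P: "P \<subseteq> {1..n}" "w k \<notin> P" "w i \<in> P" "flag_rank n F P k = card (w ` {1..k} \<inter> P)" for w i k P
  proof -
    have k: "{1..k} = insert k {1..<k}" "k \<le> n" "{1..<k} = {1..k - 1}" "k - 1 \<le> n" using ik by auto
    have "w i \<notin> w ` {1..<k}" using ik permutes_inj[OF w] by (simp add: inj_image_mem_iff)
    thus ?thesis
      using flag_minor_exchange_0[OF F k(2) _ _ P(1,2) _ P(3), of "w ` {1..<k}"] P(4) ik
        permutes_prefix[OF w k(4)] unfolding k(1,3) by (simp flip: k(3))
  qed
  have mem: "w i \<in> {1..n}" if "w permutes {1..n}" "i \<in> {1..n}" for w i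
    using that by (metis permutes_in_image)
  have "flag_minor n F (u ` {1..<k} \<union> {x}) = 0" if "(x, k) \<in> rothe n a u" for x k
  proof -
    from that obtain i where i: "x = u i" "i \<in> {1..n}" "k \<in> {1..n}" "k < i" "cyc_less n (a k) (u i) (u k)"
      unfolding rothe_def by auto
    let ?P = "cyc_ivl n (a k) (u k)"
    have ak: "a k \<in> {1..n}" and uk: "u k \<in> {1..n}" using a i mem[OF u] by auto
    have "u i \<in> ?P" "u k \<notin> ?P"
      using i(5) cyc_ivl_initial[OF ak uk] cyc_less_iff[OF ak] by auto
    thus ?thesis using minor0[OF u i(2-4) cyc_ivl_subset[OF ak uk]] cond i uk
      unfolding tilted_rank_conds_def by auto
  qed
  moreover have "flag_minor n F (v ` {1..<k} \<union> {x}) = 0" if "(x, k) \<in> rothe_op n a v" for x k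
  proof -
    from that obtain i where i: "x = v i" "i \<in> {1..n}" "k \<in> {1..n}" "k < i" "cyc_less n (a k) (v k) (v i)"
      unfolding rothe_op_def by auto
    \<comment> \<open>An interval contains its left end, so it starts at \<open>v i\<close>;
      starting at \<open>v k\<close> would include \<open>v k\<close>.\<close>
    let ?P = "cyc_ivl n (v i) (a k)"
    have ak: "a k \<in> {1..n}" and vi: "v i \<in> {1..n}" using a i mem[OF v] by auto
    have "v i \<noteq> a k" using i(5) cyc_less_iff[OF ak] by auto
    hence "v i \<in> ?P" "v k \<notin> ?P"
      using i(5) cyc_ivl_final[OF ak vi] cyc_less_iff[OF ak] by auto
    thus ?thesis using minor0[OF v i(2-4) cyc_ivl_subset[OF vi ak]] cond i vi
      unfolding tilted_rank_conds_def by auto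
  qed
  ultimately show ?thesis
    using F tilted_rank_conds_imp_bases[OF cond] flag_minor_perm_nonzero[OF F u]
      flag_minor_perm_nonzero[OF F v]
    unfolding schubert_X_def schubert_Omega_def by auto
qed

lemma schubert_imp_cyc_rank_le:
  assumes X: "F \<in> schubert_X n v a" and Omega: "F \<in> schubert_Omega n u a"
    and eq: "\<And>k. k \<in> {1..<n} \<Longrightarrow> card (u ` {1..k} \<inter> cyc_ivl n (a k) (a (Suc k))) =
      card (v ` {1..k} \<inter> cyc_ivl n (a k) (a (Suc k)))"
    and k: "k \<in> {1..n}"
  shows "cyc_rank_le n (\<lambda>S. flag_rank n F S k) (u ` {1..k}) (v ` {1..k}) (a k)"
  using k
proof (induction k)
  case (Suc k)
  let ?r = "\<lambda>k S. flag_rank n F S k" and ?a = "a (Suc k)"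
  have kn: "k < n" "k \<le> n" and ak: "?a \<in> {1..n}" using Suc.prems a by auto
  \<comment> \<open>The induction hypothesis moved from \<open>a k\<close> to
    \<open>a (Suc k)\<close>. For \<open>k = 0\<close> there is no hypothesis to move, but all ranks
    in \<open>F 0\<close> are zero.\<close>
  have IH: "cyc_rank_le n (?r k) (u ` {1..k}) (v ` {1..k}) ?a"
  proof (cases "k = 0")
    case True
    thus ?thesis using flag_rank_le[OF F, of 0] unfolding cyc_rank_le_def by simp
  next
    case False
    hence k1: "k \<in> {1..n}" "k \<in> {1..<n}" and p: "a k \<in> {1..n}" using kn a by auto
    note full = flag_rank_full[OF F kn(2)]
    show ?thesis
      by (rule cyc_rank_le_shift[OF rank_function_flag_rank[OF F kn(2)] _ _ _ _ p ak eq[OF k1(2)]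
            Suc.IH[OF k1(1)]])
        (use permutes_prefix[OF u kn(2)] permutes_prefix[OF v kn(2)] in \<open>simp_all only: full\<close>)
  qed
  have step: "?r (Suc k) P \<le> card (w ` {1..Suc k} \<inter> P)"
    if w: "w permutes {1..n}" and nz: "flag_minor_perm n F w \<noteq> 0" and P: "P \<subseteq> {1..n}"
      and le: "?r k P \<le> card (w ` {1..k} \<inter> P)"
      and zero: "\<And>i. w (Suc k) \<notin> P \<Longrightarrow> i \<in> {1..n} \<Longrightarrow> Suc k < i \<Longrightarrow> w i \<in> P \<Longrightarrow>
        flag_minor n F (w ` {1..<Suc k} \<union> {w i}) = 0" for w P
  proof -
    have "Suc k \<notin> {1..k}" by simp
    hence x: "w (Suc k) \<in> {1..n}" "w (Suc k) \<notin> w ` {1..k}"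
      using Suc.prems permutes_in_image[OF w] permutes_inj[OF w] by (simp_all add: inj_image_mem_iff)
    have "flag_minor n F (w ` {1..Suc k}) \<noteq> 0"
      using nz Suc.prems unfolding flag_minor_perm_def by simp
    hence min: "flag_minor n F (insert (w (Suc k)) (w ` {1..k})) \<noteq> 0"
      unfolding image_atLeastAtMost_Suc .
    have rk: "?r k (w ` {1..k}) = k"
      using nz kn flag_rank_empty[OF F, of 0] unfolding flag_minor_perm_nonzero[OF F w]
      by (cases "k = 0") auto
    show ?thesis unfolding image_atLeastAtMost_Suc
    proof (rule flag_rank_Suc_le_card[OF F kn(1) permutes_prefix[OF w kn(2)] rk x min P le])
      fix y assume y: "w (Suc k) \<notin> P" "y \<in> P" "y \<notin> w ` {1..k}"
      then obtain i where i: "y = w i" "i \<in> {1..n}" using P permutes_image[OF w] by blast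
      \<comment> \<open>The value \<open>w i\<close> lies outside the prefix of length
        \<open>k\<close>, and it is not \<open>w (Suc k)\<close>, which is outside
        \<open>P\<close>.\<close>
      hence "Suc k < i" using y by (cases "i = Suc k") auto
      thus "flag_minor n F (w ` {1..k} \<union> {y}) = 0"
        using zero[OF y(1) i(2)] y(2) unfolding i(1) by (simp add: atLeastLessThanSuc_atLeastAtMost)
    qed
  qed
  show ?case unfolding cyc_rank_le_def
  proof (intro ballI conjI)
    fix i assume i: "i \<in> {1..n}"
    have uk: "u (Suc k) \<in> {1..n}" and vk: "v (Suc k) \<in> {1..n}"
      using Suc.prems permutes_in_image[OF u] permutes_in_image[OF v] by blast+
    show "?r (Suc k) (cyc_ivl n ?a i) \<le> card (u ` {1..Suc k} \<inter> cyc_ivl n ?a i)"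
    proof (rule step[OF u _ cyc_ivl_subset[OF ak i]])
      show "flag_minor_perm n F u \<noteq> 0" using Omega unfolding schubert_Omega_def by simp
      show "?r k (cyc_ivl n ?a i) \<le> card (u ` {1..k} \<inter> cyc_ivl n ?a i)"
        using IH i unfolding cyc_rank_le_def by simp
      fix j assume j: "u (Suc k) \<notin> cyc_ivl n ?a i" "j \<in> {1..n}" "Suc k < j" "u j \<in> cyc_ivl n ?a i"
      \<comment> \<open>An initial segment of the order contains \<open>u j\<close> but not
        \<open>u (Suc k)\<close>, so \<open>u j\<close> comes first. For \<open>v\<close> the final
        segments reverse this comparison.\<close>
      hence "cyc_less n ?a (u j) (u (Suc k))"
        using uk unfolding cyc_ivl_initial[OF ak i] mem_Collect_eq cyc_less_iff[OF ak] by auto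
      hence "(u j, Suc k) \<in> rothe n a u" using j Suc.prems unfolding rothe_def by blast
      thus "flag_minor n F (u ` {1..<Suc k} \<union> {u j}) = 0"
        using Omega unfolding schubert_Omega_def by fast
    qed
    show "?r (Suc k) (cyc_ivl n i ?a) \<le> card (v ` {1..Suc k} \<inter> cyc_ivl n i ?a)"
    proof (rule step[OF v _ cyc_ivl_subset[OF i ak]])
      show "flag_minor_perm n F v \<noteq> 0" using X unfolding schubert_X_def by simp
      show "?r k (cyc_ivl n i ?a) \<le> card (v ` {1..k} \<inter> cyc_ivl n i ?a)"
        using IH i unfolding cyc_rank_le_def by simp
      fix j assume j: "v (Suc k) \<notin> cyc_ivl n i ?a" "j \<in> {1..n}" "Suc k < j" "v j \<in> cyc_ivl n i ?a"
      have ne: "i \<noteq> ?a" using j(4) by (auto simp: cyc_ivl_def)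
      have "cyc_less n ?a (v (Suc k)) (v j)"
        using j(1,4) i vk unfolding cyc_ivl_final[OF ak i ne] insert_iff mem_Collect_eq cyc_less_iff[OF ak]
        by auto
      hence "(v j, Suc k) \<in> rothe_op n a v" using j Suc.prems unfolding rothe_op_def by blast
      thus "flag_minor n F (v ` {1..<Suc k} \<union> {v j}) = 0"
        using X unfolding schubert_X_def by fast
    qed
  qed
qed simp

text \<open>The upper bounds come from the induction; the lower ones hold because the nonzero minors
  make the prefixes of \<open>u\<close> and \<open>v\<close> independent.\<close>

lemma schubert_imp_tilted_rank_conds:
  assumes X: "F \<in> schubert_X n v a" and Omega: "F \<in> schubert_Omega n u a"
    and less: "tilted_lesssim n a u v"
  shows "tilted_rank_conds n a u v F"
  unfolding tilted_rank_conds_def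
proof (intro ballI conjI)
  fix i k assume i: "i \<in> {1..n}" and k: "k \<in> {1..n}"
  have kn: "k \<le> n" and ak: "a k \<in> {1..n}" using a k by auto
  interpret rank_function "{1..n}" "\<lambda>S. flag_rank n F S k" by (rule rank_function_flag_rank[OF F kn])
  have le: "cyc_rank_le n (\<lambda>S. flag_rank n F S k) (u ` {1..k}) (v ` {1..k}) (a k)"
    using less by (intro schubert_imp_cyc_rank_le[OF X Omega _ k]) (auto simp: tilted_lesssim_def)
  have ge: "card (w ` {1..k} \<inter> P) \<le> flag_rank n F P k"
    if "w permutes {1..n}" "flag_minor_perm n F w \<noteq> 0" "P \<subseteq> {1..n}" for w P
    using that k flag_minor_perm_nonzero[OF F that(1)] permutes_prefix[OF that(1) kn]
    by (intro card_Int_le_rank) auto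
  show "flag_rank n F (cyc_ivl n (a k) i) k = card (u ` {1..k} \<inter> cyc_ivl n (a k) i)"
    using le i ge[OF u _ cyc_ivl_subset[OF ak i]] Omega
    unfolding cyc_rank_le_def schubert_Omega_def by (auto intro: antisym)
  show "flag_rank n F (cyc_ivl n i (a k)) k = card (v ` {1..k} \<inter> cyc_ivl n i (a k))"
    using le i ge[OF v _ cyc_ivl_subset[OF i ak]] X
    unfolding cyc_rank_le_def schubert_X_def by (auto intro: antisym)
qed

end

theorem theorem4p21:
  fixes n :: nat and u v a :: "nat \<Rightarrow> nat"
  assumes "u permutes {1..n}" and "v permutes {1..n}"
    and "a \<in> {1..n} \<rightarrow> {1..n}"
  shows "(tilted_le n a u v \<longrightarrow>
            tilted_richardson n u v \<subseteq> schubert_X n v a \<inter> schubert_Omega n u a) \<and>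
         (tilted_lesssim n a u v \<longrightarrow>
            tilted_richardson n u v = schubert_X n v a \<inter> schubert_Omega n u a)"
proof -
  have sub: "tilted_richardson n u v \<subseteq> schubert_X n v a \<inter> schubert_Omega n u a" if "tilted_le n a u v"
    using tilted_richardson_eq[OF assms that] tilted_rank_conds_imp_schubert[OF assms] by blast
  moreover have "schubert_X n v a \<inter> schubert_Omega n u a \<subseteq> tilted_richardson n u v"
    if less: "tilted_lesssim n a u v"
  proof -
    have "tilted_le n a u v" using less unfolding tilted_lesssim_def by simp
    thus ?thesis
      using tilted_richardson_eq[OF assms] schubert_imp_tilted_rank_conds[OF assms _ _ _ less]
      unfolding schubert_X_def by blast
  qed
  ultimately show ?thesis unfolding tilted_lesssim_def by blast
qed

end
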